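(* Let $d\in\mathbb N$, let $a<b$ be real numbers and $I=(a,b)$. Let $W:\mathbb R^d\times\mathbb R^d\to\mathbb R$ be coercive, lower semicontinuous, diagonal and symmetric, and let $J$ be the functional defined on $W^{1,\infty}(I;\mathbb R^d)$ by $$J(u):=\operatorname*{ess\,sup}_{(x,y)\in I\times I}W(u'(x),u'(y)).$$ Then $J$ is (sequentially) lower semicontinuous with respect to the $W^{1,\infty}$-weak* topology if and only if $W$ is Cartesian level convex.
   Context: For a function $W:\mathbb R^d\times\mathbb R^d\to\mathbb R$ and $c\in\mathbb R$, let $L_c(W):=\{(\xi,\eta)\in\mathbb R^d\times\mathbb R^d: W(\xi,\eta)\le c\}$. $W$ is coercive if there is $C'>0$ with $C'|(\xi,\eta)|\le W(\xi,\eta)$ for all $\xi,\eta\in\mathbb R^d$. $W$ is symmetric if $W(\xi,\eta)=W(\eta,\xi)$ for all $\xi,\eta$. $W$ is diagonal if for every $c\in\mathbb R$, $(\xi,\eta)\in L_c(W)$ implies $(\xi,\xi),(\eta,\eta)\in L_c(W)$; equivalently $W(\xi,\eta)=\max\{W(\xi,\xi),W(\xi,\eta),W(\eta,\eta)\}$ for all $\xi,\eta$. A set $E\subset\mathbb R^d\times\mathbb R^d$ is Cartesian convex if, for every $A\subset\mathbb R^d$, $A\times A\subset E$ implies $A^{co}\times A^{co}\subset E$, where $A^{co}$ denotes the convex hull of $A$. $W$ is Cartesian level convex if $L_c(W)$ is Cartesian convex for every $c\in\mathbb R$. Weak* convergence $u_j\overset{*}{\rightharpoonup}u$ in $W^{1,\infty}(I;\mathbb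 R^d)$ means $u_j\overset{*}{\rightharpoonup}u$ and $u_j'\overset{*}{\rightharpoonup}u'$ in $L^\infty(I;\mathbb R^d)$. Sequential lower semicontinuity of $J$ means $J(u)\le\liminf_{j\to\infty}J(u_j)$ whenever $u_j\overset{*}{\rightharpoonup}u$ in $W^{1,\infty}(I;\mathbb R^d)$. The functional $J$ is allowed to take the value $+\infty$. *)

theory Defs
  imports "HOL-Analysis.Analysis" "HOL-Probability.Essential_Supremum"
begin

section \<open>Properties of the density\<close>

definition sublevel :: "('e \<times> 'e \<Rightarrow> real) \<Rightarrow> real \<Rightarrow> ('e \<times> 'e) set" where
  "sublevel W c = {p. W p \<le> c}"

definition coercive :: "('e::real_normed_vector \<times> 'e \<Rightarrow> real) \<Rightarrow> bool" where
  "coercive W \<longleftrightarrow> (\<exists>C>0. \<forall>\<xi> \<eta>. C * norm (\<xi>, \<eta>) \<le> W (\<xi>, \<eta>))"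

definition lower_semicontinuous :: "('p::topological_space \<Rightarrow> real) \<Rightarrow> bool" where
  "lower_semicontinuous W \<longleftrightarrow> (\<forall>p. ereal (W p) \<le> Liminf (at p) (\<lambda>q. ereal (W q)))"

definition symmetric :: "('e \<times> 'e \<Rightarrow> real) \<Rightarrow> bool" where
  "symmetric W \<longleftrightarrow> (\<forall>\<xi> \<eta>. W (\<xi>, \<eta>) = W (\<eta>, \<xi>))"

definition diagonal :: "('e \<times> 'e \<Rightarrow> real) \<Rightarrow> bool" where
  "diagonal W \<longleftrightarrow> (\<forall>c \<xi> \<eta>. (\<xi>, \<eta>) \<in> sublevel W c \<longrightarrow>
     (\<xi>, \<xi>) \<in> sublevel W c \<and> (\<eta>, \<eta>) \<in> sublevel W c)"

definition cartesian_convex :: "('e::real_vector \<times> 'e) set \<Rightarrow> bool" where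
  "cartesian_convex E \<longleftrightarrow>
     (\<forall>A. A \<times> A \<subseteq> E \<longrightarrow> (convex hull A) \<times> (convex hull A) \<subseteq> E)"

definition cartesian_level_convex :: "('e::real_vector \<times> 'e \<Rightarrow> real) \<Rightarrow> bool" where
  "cartesian_level_convex W \<longleftrightarrow> (\<forall>c. cartesian_convex (sublevel W c))"

section \<open>The Sobolev space \<open>W\<^sup>1\<^sup>,\<^sup>\<infinity>\<close> on the interval \<open>(a, b)\<close>\<close>

text \<open>
  Elements of \<open>L\<^sup>\<infinity>\<close> and \<open>W\<^sup>1\<^sup>,\<^sup>\<infinity>\<close> are represented by functions on all of \<open>real\<close>;
  only their values almost everywhere in the interval matter.
\<close>

definition Linf :: "real \<Rightarrow> real \<Rightarrow> (real \<Rightarrow> 'e::euclidean_space) set" where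
  "Linf a b = {u \<in> borel_measurable (lebesgue_on {a<..<b}).
     \<exists>C. AE x in lebesgue_on {a<..<b}. norm (u x) \<le> C}"

definition test_function :: "real \<Rightarrow> real \<Rightarrow> (real \<Rightarrow> real) \<Rightarrow> bool" where
  "test_function a b \<phi> \<longleftrightarrow>
     (\<forall>k x. ((deriv ^^ k) \<phi>) differentiable (at x)) \<and>
     compact (closure {x. \<phi> x \<noteq> 0}) \<and> closure {x. \<phi> x \<noteq> 0} \<subseteq> {a<..<b}"

definition has_weak_deriv ::
  "real \<Rightarrow> real \<Rightarrow> (real \<Rightarrow> 'e::euclidean_space) \<Rightarrow> (real \<Rightarrow> 'e) \<Rightarrow> bool" where
  "has_weak_deriv a b u v \<longleftrightarrow> (\<forall>\<phi>. test_function a b \<phi> \<longrightarrow>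
     (LINT x|lebesgue_on {a<..<b}. deriv \<phi> x *\<^sub>R u x) =
     - (LINT x|lebesgue_on {a<..<b}. \<phi> x *\<^sub>R v x))"

definition W1inf :: "real \<Rightarrow> real \<Rightarrow> (real \<Rightarrow> 'e::euclidean_space) set" where
  "W1inf a b = {u \<in> Linf a b. \<exists>v\<in>Linf a b. has_weak_deriv a b u v}"

text \<open>
  A representative of the weak derivative, which is unique up to null sets of the interval.
\<close>

definition weak_deriv :: "real \<Rightarrow> real \<Rightarrow> (real \<Rightarrow> 'e::euclidean_space) \<Rightarrow> real \<Rightarrow> 'e" where
  "weak_deriv a b u = (SOME v. v \<in> Linf a b \<and> has_weak_deriv a b u v)"

text \<open>Weak* convergence in \<open>L\<^sup>\<infinity>\<close>, seen as the dual of \<open>L\<^sup>1\<close>.\<close>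

definition Linf_weak_star_conv ::
  "real \<Rightarrow> real \<Rightarrow> (nat \<Rightarrow> real \<Rightarrow> 'e::euclidean_space) \<Rightarrow> (real \<Rightarrow> 'e) \<Rightarrow> bool" where
  "Linf_weak_star_conv a b u v \<longleftrightarrow> (\<forall>g. integrable (lebesgue_on {a<..<b}) g \<longrightarrow>
     (\<lambda>j. LINT x|lebesgue_on {a<..<b}. u j x \<bullet> g x)
       \<longlonglongrightarrow> (LINT x|lebesgue_on {a<..<b}. v x \<bullet> g x))"

definition W1inf_weak_star_conv ::
  "real \<Rightarrow> real \<Rightarrow> (nat \<Rightarrow> real \<Rightarrow> 'e::euclidean_space) \<Rightarrow> (real \<Rightarrow> 'e) \<Rightarrow> bool" where
  "W1inf_weak_star_conv a b u v \<longleftrightarrow>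
     Linf_weak_star_conv a b u v \<and>
     Linf_weak_star_conv a b (\<lambda>j. weak_deriv a b (u j)) (weak_deriv a b v)"

section \<open>The functional and its lower semicontinuity\<close>

text \<open>
  \<open>esssup\<close> returns \<open>top\<close> on non-measurable functions; this does not occur below, since a
  lower semicontinuous density is Borel and weak derivatives are Lebesgue measurable.
\<close>

definition J ::
  "real \<Rightarrow> real \<Rightarrow> ('e::euclidean_space \<times> 'e \<Rightarrow> real) \<Rightarrow> (real \<Rightarrow> 'e) \<Rightarrow> ereal" where
  "J a b W u = esssup (lebesgue_on ({a<..<b} \<times> {a<..<b}))
     (\<lambda>(x, y). ereal (W (weak_deriv a b u x, weak_deriv a b u y)))"

definition seq_weak_star_lsc ::
  "real \<Rightarrow> real \<Rightarrow> ((real \<Rightarrow> 'e::euclidean_space) \<Rightarrow> ereal) \<Rightarrow> bool" where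
  "seq_weak_star_lsc a b F \<longleftrightarrow>
     (\<forall>u v. (\<forall>j. u j \<in> W1inf a b) \<and> v \<in> W1inf a b \<and> W1inf_weak_star_conv a b u v \<longrightarrow>
        F v \<le> liminf (\<lambda>j. F (u j)))"

end

theory Submission
  imports Defs
begin

text \<open>
  Sufficiency. Fix a level \<open>c\<close> and write \<open>E\<close> for the closed set \<open>sublevel W c\<close>. A bound
  \<open>J u \<le> c\<close> says that \<open>(u'(x), u'(y)) \<in> E\<close> for almost every pair, and this is a statement about
  the essential range \<open>A\<close> of \<open>u'\<close>: it gives \<open>A \<times> A \<subseteq> E\<close>
  (\<open>essential_range_square_subset\<close>), because \<open>E\<close> is closed and a product of two sets of positive
  measure has positive measure. Cartesian convexity and closedness enlarge this to \<open>K \<times> K \<subseteq> E\<close>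
  with \<open>K\<close> the closed convex hull of \<open>A\<close>. Averages of \<open>u'\<close> over any set of positive measure lie
  in \<open>K\<close> (\<open>average_in_closed_convex\<close>), hence pairs of averages lie in \<open>E\<close>. Averages pass to
  weak* limits, so pairs of averages of the limit derivative \<open>v'\<close> lie in \<open>E\<close> too; averaging over
  the sets where \<open>v'\<close> is close to a point of its essential range shows that the square of the
  essential range of \<open>v'\<close> lies in \<open>E\<close>, which is \<open>J v \<le> c\<close>.

  Necessity. Let \<open>A \<times> A \<subseteq> E\<close>, and let \<open>\<xi>\<close> and \<open>\<eta>\<close> be convex combinations of two points of \<open>A\<close>.
  The function with derivative \<open>\<xi>\<close> on the left half of the interval and \<open>\<eta>\<close> on the right half is
  the weak* limit of functions whose derivatives oscillate rapidly between the two points of \<open>A\<close>,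
  with the right proportions. The oscillating functions have energy at most \<open>c\<close>, hence so has the
  limit, and since both halves have positive measure this means \<open>(\<xi>, \<eta>) \<in> E\<close>
  (\<open>weak_star_lsc_two_point_convex\<close>). Thus the set of two-point combinations of \<open>A\<close> has
  its square in \<open>E\<close> again; iterating reaches the whole convex hull
  (\<open>cartesian_convex_of_two_point\<close>).

  Three facts of one-dimensional analysis support the construction. A bounded sequence converges
  weakly* to zero as soon as its integrals over compact subintervals do
  (\<open>weak_star_zero_of_interval_integrals\<close>, a Dynkin-class argument). A bounded function is the weak
  derivative of its primitive (\<open>has_weak_deriv_primitive\<close>, by Fubini). The weak derivative is unique
  (\<open>weak_deriv_unique\<close>): explicit bump functions turn equality against all test functions into
  equality of integrals over intervals, and the criterion just mentioned, applied to a constant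
  sequence, then makes the difference vanish.
\<close>

section \<open>Lebesgue measure on a square\<close>

text \<open>
  Lebesgue measure on a product is the completion of the product of the Borel versions, and not a
  product measure itself. The projections are nevertheless measurable between the completions,
  because a cylinder over a null set is a null set.
\<close>

lemma fst_measurable_lebesgue:
  "fst \<in> (lebesgue :: ('a::euclidean_space \<times> 'b::euclidean_space) measure) \<rightarrow>\<^sub>M lebesgue"
proof (rule completion.measurable_completion2)
  show "fst \<in> (lebesgue :: ('a \<times> 'b) measure) \<rightarrow>\<^sub>M lborel"
    by (intro measurable_completion) (simp add: borel_measurable_continuous_onI continuous_on_fst)
  then have m: "fst \<in> (lebesgue :: ('a \<times> 'b) measure) \<rightarrow>\<^sub>M lborel" .
  have "(fst :: 'a \<times> 'b \<Rightarrow> 'a) -` N \<in> null_sets lebesgue" if "N \<in> null_sets lborel" for N :: "'a set"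
  proof -
    have "N \<times> (UNIV :: 'b set) \<in> null_sets lborel"
      using that by (subst lborel_prod[symmetric]) auto
    moreover have "(fst :: 'a \<times> 'b \<Rightarrow> 'a) -` N = N \<times> (UNIV :: 'b set)" by auto
    ultimately show ?thesis by (simp only: null_sets_completionI)
  qed
  then show "null_sets lborel \<subseteq> null_sets (distr (lebesgue :: ('a \<times> 'b) measure) lborel fst)"
    using m null_setsD2[of _ "lborel :: _ measure"] by (auto simp: null_sets_distr_iff sets_lborel)
qed

lemma snd_measurable_lebesgue:
  "snd \<in> (lebesgue :: ('a::euclidean_space \<times> 'b::euclidean_space) measure) \<rightarrow>\<^sub>M lebesgue"
proof (rule completion.measurable_completion2)
  show "snd \<in> (lebesgue :: ('a \<times> 'b) measure) \<rightarrow>\<^sub>M lborel"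
    by (intro measurable_completion) (simp add: borel_measurable_continuous_onI continuous_on_snd)
  then have m: "snd \<in> (lebesgue :: ('a \<times> 'b) measure) \<rightarrow>\<^sub>M lborel" .
  have "(snd :: 'a \<times> 'b \<Rightarrow> 'b) -` N \<in> null_sets lebesgue" if "N \<in> null_sets lborel" for N :: "'b set"
  proof -
    have "(UNIV :: 'a set) \<times> N \<in> null_sets lborel"
      using that by (subst lborel_prod[symmetric]) auto
    moreover have "(snd :: 'a \<times> 'b \<Rightarrow> 'b) -` N = (UNIV :: 'a set) \<times> N" by auto
    ultimately show ?thesis by (simp only: null_sets_completionI)
  qed
  then show "null_sets lborel \<subseteq> null_sets (distr (lebesgue :: ('a \<times> 'b) measure) lborel snd)"
    using m null_setsD2[of _ "lborel :: _ measure"] by (auto simp: null_sets_distr_iff sets_lborel)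
qed

text \<open>
  The functional \<open>J\<close> lives on the square with two-dimensional Lebesgue measure, while everything
  known about derivatives holds almost everywhere on the line; the next two lemmas translate
  between the two in both directions.
\<close>

lemma AE_lebesgue_square_slices:
  fixes S :: "'a::euclidean_space set"
  assumes "S \<in> sets borel" "AE p in lebesgue_on (S \<times> S). P p"
  shows "AE x in lebesgue_on S. AE y in lebesgue_on S. P (x, y)"
proof -
  have [simp]: "S \<in> sets lebesgue" using assms(1) by simp
  have SS: "S \<times> S \<in> sets borel" using assms(1) by (rule borel_Times) fact
  have "AE p in lborel. p \<in> S \<times> S \<longrightarrow> P p"
    using assms(2) SS by (simp add: AE_restrict_space_iff AE_completion_iff)
  then have "AE p in lborel \<Otimes>\<^sub>M lborel. p \<in> S \<times> S \<longrightarrow> P p"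
    by (simp only: lborel_prod)
  then have "AE x in lborel. AE y in lborel. (x, y) \<in> S \<times> S \<longrightarrow> P (x, y)"
    by (rule lborel_pair.AE_pair)
  then show ?thesis
    by (auto simp: AE_restrict_space_iff AE_completion_iff elim: eventually_mono)
qed

lemma AE_lebesgue_square_coordinates:
  fixes S :: "'a::euclidean_space set"
  assumes "S \<in> sets borel" "AE x in lebesgue_on S. P x"
  shows "AE p in lebesgue_on (S \<times> S). P (fst p) \<and> P (snd p)"
proof -
  have [simp]: "S \<in> sets lebesgue" using assms(1) by simp
  have SS: "S \<times> S \<in> sets borel" using assms(1) by (rule borel_Times) fact
  have "AE x in lborel. x \<in> S \<longrightarrow> P x"
    using assms(2) by (simp add: AE_restrict_space_iff AE_completion_iff)
  then obtain N where N: "N \<in> null_sets lborel" "{x. \<not> (x \<in> S \<longrightarrow> P x)} \<subseteq> N"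
    unfolding eventually_ae_filter by auto
  then have "N \<times> (UNIV :: 'a set) \<in> null_sets lborel" "(UNIV :: 'a set) \<times> N \<in> null_sets lborel"
    by (subst lborel_prod[symmetric], auto)+
  from AE_not_in[OF this(1)] AE_not_in[OF this(2)]
  have "AE p in lborel. p \<in> S \<times> S \<longrightarrow> P (fst p) \<and> P (snd p)"
    by eventually_elim (use N in auto)
  moreover have "S \<times> S \<inter> space lebesgue \<in> sets lebesgue" using SS by simp
  ultimately show ?thesis by (simp only: AE_restrict_space_iff AE_completion_iff)
qed

section \<open>Essential range and averages\<close>

definition essential_range :: "'a measure \<Rightarrow> ('a \<Rightarrow> 'e::topological_space) \<Rightarrow> 'e set" where
  "essential_range M f = {\<xi>. \<forall>U. open U \<longrightarrow> \<xi> \<in> U \<longrightarrow> \<not> (AE x in M. f x \<notin> U)}"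

text \<open>
  A countable base suffices to witness all the points outside the essential range, so the
  exceptional set is a countable union of null sets.
\<close>

lemma AE_in_essential_range:
  fixes f :: "'a \<Rightarrow> 'e::second_countable_topology"
  shows "AE x in M. f x \<in> essential_range M f"
proof -
  obtain B :: "'e set set" where B: "countable B" "topological_basis B"
    using ex_countable_basis by blast
  define B0 where "B0 = {U\<in>B. AE x in M. f x \<notin> U}"
  have "countable B0" using B(1) by (simp add: B0_def)
  then have "AE x in M. \<forall>U\<in>B0. f x \<notin> U"
    by (subst AE_ball_countable) (auto simp: B0_def)
  then show ?thesis
  proof (rule eventually_mono)
    fix x assume x: "\<forall>U\<in>B0. f x \<notin> U"
    show "f x \<in> essential_range M f"
      unfolding essential_range_def
    proof (clarify)
      fix U assume U: "open U" "f x \<in> U" "AE y in M. f y \<notin> U"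
      obtain V where V: "V \<in> B" "f x \<in> V" "V \<subseteq> U"
        using topological_basisE[OF B(2) U(1,2)] by blast
      have "AE y in M. f y \<notin> V" using U(3) V(3) by (auto elim: eventually_mono)
      then have "V \<in> B0" using V(1) by (simp add: B0_def)
      with x V(2) show False by blast
    qed
  qed
qed

text \<open>
  A point of the square outside \<open>E\<close> has a product neighbourhood \<open>U \<times> V\<close> disjoint from \<open>E\<close>, and
  \<open>f\<close> takes values in \<open>U\<close> and in \<open>V\<close> on non-null sets.
\<close>

lemma essential_range_square_subset:
  assumes E: "closed E" and ae: "AE x in M. AE y in M. (f x, f y) \<in> E"
  shows "essential_range M f \<times> essential_range M f \<subseteq> E"
proof clarify
  fix \<xi> \<eta> assume r: "\<xi> \<in> essential_range M f" "\<eta> \<in> essential_range M f"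
  show "(\<xi>, \<eta>) \<in> E"
  proof (rule ccontr)
    assume "(\<xi>, \<eta>) \<notin> E"
    then obtain U V where UV: "open U" "open V" "\<xi> \<in> U" "\<eta> \<in> V" "U \<times> V \<subseteq> - E"
      using open_prod_elim[of "- E" "(\<xi>, \<eta>)"] E
      by (metis ComplI SigmaE2 SigmaI open_Compl)
    have "AE x in M. f x \<notin> U"
      using ae
    proof (rule eventually_mono)
      fix x assume x: "AE y in M. (f x, f y) \<in> E"
      show "f x \<notin> U"
      proof
        assume "f x \<in> U"
        then have "AE y in M. f y \<notin> V" using x UV(5) by (auto elim: eventually_mono)
        then show False using r(2) UV(2,4) by (auto simp: essential_range_def)
      qed
    qed
    then show False using r(1) UV(1,3) by (auto simp: essential_range_def)
  qed
qed

text \<open>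
  A hyperplane separating the average from \<open>K\<close> would also separate it from almost every value of
  \<open>f\<close> on \<open>P\<close>, which contradicts the monotonicity of the integral.
\<close>

lemma average_in_closed_convex:
  fixes f :: "'a \<Rightarrow> 'e::euclidean_space"
  assumes f: "integrable M f" and P: "P \<in> sets M" "measure M P > 0"
    and fin: "emeasure M P < \<infinity>"
    and K: "closed K" "convex K" and ae: "AE x in M. x \<in> P \<longrightarrow> f x \<in> K"
  shows "(LINT x|M. indicator P x *\<^sub>R f x) /\<^sub>R measure M P \<in> K"
proof (rule ccontr)
  let ?m = "(LINT x|M. indicator P x *\<^sub>R f x) /\<^sub>R measure M P"
  assume "?m \<notin> K"
  then obtain a b where ab: "a \<bullet> ?m < b" "\<And>x. x \<in> K \<Longrightarrow> b < a \<bullet> x"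
    using separating_hyperplane_closed_point[OF K(2,1)] by blast
  have ifP: "integrable M (\<lambda>x. indicator P x *\<^sub>R f x)"
    using f P(1) by (intro integrable_mult_indicator)
  have iP: "integrable M (indicator P :: _ \<Rightarrow> real)"
    using P(1) fin by simp
  have "AE x in M. b * indicator P x \<le> a \<bullet> (indicator P x *\<^sub>R f x)"
    using ae by eventually_elim (auto simp: indicator_def intro: less_imp_le ab(2))
  then have "(LINT x|M. b * indicator P x) \<le> (LINT x|M. a \<bullet> (indicator P x *\<^sub>R f x))"
    by (rule integral_mono_AE[rotated 2]) (intro integrable_mult_right iP integrable_inner_right ifP)+
  then have "b * measure M P \<le> (LINT x|M. a \<bullet> (indicator P x *\<^sub>R f x))"
    using P(1) sets.sets_into_space[OF P(1)] by (simp add: Int_absorb2)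
  also have "\<dots> = a \<bullet> (LINT x|M. indicator P x *\<^sub>R f x)"
    by (rule integral_inner_right) (rule ifP)
  also have "\<dots> = (a \<bullet> ?m) * measure M P"
    using P(2) by simp
  finally show False using ab(1) P(2) by simp
qed

section \<open>Sublevels of the density and of the functional\<close>

lemma open_superlevel_lower_semicontinuous:
  fixes W :: "'p::topological_space \<Rightarrow> real"
  assumes "lower_semicontinuous W"
  shows "open {p. c < W p}"
proof (subst open_subopen, clarify)
  fix p assume "c < W p"
  then have "ereal c < Liminf (at p) (\<lambda>q. ereal (W q))"
    using assms unfolding lower_semicontinuous_def by (metis less_ereal.simps(1) less_le_trans)
  then have "\<forall>\<^sub>F q in at p. c < W q" by (auto dest: less_LiminfD)
  then obtain S where "open S" "p \<in> S" "\<And>q. q \<in> S \<Longrightarrow> q \<noteq> p \<Longrightarrow> c < W q"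
    by (auto simp: eventually_at_topological)
  then show "\<exists>T. open T \<and> p \<in> T \<and> T \<subseteq> {p. c < W p}"
    using \<open>c < W p\<close> by (intro exI[of _ S]) blast
qed

lemma closed_sublevel:
  assumes "lower_semicontinuous W"
  shows "closed (sublevel W c)"
proof -
  have "sublevel W c = - {p. c < W p}" by (auto simp: sublevel_def)
  then show ?thesis using open_superlevel_lower_semicontinuous[OF assms, of c] by (metis closed_Compl)
qed

lemma borel_measurable_lower_semicontinuous:
  fixes W :: "'p::topological_space \<Rightarrow> real"
  assumes "lower_semicontinuous W"
  shows "W \<in> borel_measurable borel"
  by (rule borel_measurableI_greater) (simp add: open_superlevel_lower_semicontinuous[OF assms])

text \<open>
  \<open>esssup\<close> is \<open>top\<close> on functions that are not measurable, so an almost everywhere bound on the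
  density controls \<open>J\<close> only together with this measurability.
\<close>

lemma measurable_square_density:
  fixes v :: "'a::euclidean_space \<Rightarrow> 'e::euclidean_space" and W :: "'e \<times> 'e \<Rightarrow> real"
  assumes S: "S \<in> sets borel" and v: "v \<in> borel_measurable (lebesgue_on S)"
    and W: "lower_semicontinuous W"
  shows "(\<lambda>(x, y). ereal (W (v x, v y))) \<in> borel_measurable (lebesgue_on (S \<times> S))"
proof -
  have SS: "S \<times> S \<in> sets borel" using S by (rule borel_Times) fact
  have "fst \<in> lebesgue_on (S \<times> S) \<rightarrow>\<^sub>M lebesgue_on S" "snd \<in> lebesgue_on (S \<times> S) \<rightarrow>\<^sub>M lebesgue_on S"
    by (auto intro!: measurable_restrict_space3 fst_measurable_lebesgue snd_measurable_lebesgue)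
  from this[THEN measurable_compose[OF _ v]]
  have "(\<lambda>p. (v (fst p), v (snd p))) \<in> borel_measurable (lebesgue_on (S \<times> S))"
    by (intro borel_measurable_Pair) auto
  from measurable_compose[OF this borel_measurable_lower_semicontinuous[OF W]]
  show ?thesis by (simp add: case_prod_beta')
qed

lemma J_le_iff_AE:
  fixes u :: "real \<Rightarrow> 'e::euclidean_space"
  assumes v: "weak_deriv a b u \<in> borel_measurable (lebesgue_on {a<..<b})"
    and W: "lower_semicontinuous W"
  shows "J a b W u \<le> ereal c \<longleftrightarrow>
    (AE p in lebesgue_on ({a<..<b} \<times> {a<..<b}).
      (weak_deriv a b u (fst p), weak_deriv a b u (snd p)) \<in> sublevel W c)"
    (is "_ \<longleftrightarrow> (AE p in ?M. ?P p)")
proof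
  assume le: "J a b W u \<le> ereal c"
  show "AE p in ?M. ?P p"
    using esssup_AE[where M = ?M and f = "\<lambda>(x, y). ereal (W (weak_deriv a b u x, weak_deriv a b u y))"]
    by eventually_elim
      (use le in \<open>auto simp: J_def sublevel_def dest: order_trans\<close>)
next
  assume "AE p in ?M. ?P p"
  then show "J a b W u \<le> ereal c" unfolding J_def
    by (intro esssup_I measurable_square_density[OF _ v W])
      (auto simp: sublevel_def elim: eventually_mono)
qed

section \<open>Sufficiency: the constraint passes to weak* limits\<close>

lemma finite_measure_lebesgue_interval:
  "finite_measure (lebesgue_on {a<..<b::real})"
  using emeasure_bounded_finite[of "{a<..<b}"]
  by (auto intro!: finite_measureI simp: emeasure_restrict_space space_restrict_space)

lemma integrable_Linf:
  assumes "v \<in> Linf a b"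
  shows "integrable (lebesgue_on {a<..<b}) v"
proof -
  interpret finite_measure "lebesgue_on {a<..<b}" by (rule finite_measure_lebesgue_interval)
  show ?thesis using assms unfolding Linf_def by (auto intro: integrable_const_bound)
qed

lemma weak_deriv_works:
  assumes "u \<in> W1inf a b"
  shows "weak_deriv a b u \<in> Linf a b" "has_weak_deriv a b u (weak_deriv a b u)"
proof -
  have "\<exists>v. v \<in> Linf a b \<and> has_weak_deriv a b u v" using assms by (auto simp: W1inf_def)
  from someI_ex[OF this] show "weak_deriv a b u \<in> Linf a b" "has_weak_deriv a b u (weak_deriv a b u)"
    by (auto simp: weak_deriv_def)
qed

text \<open>
  Weak* convergence is tested against vector-valued functions; testing with an indicator times each
  basis vector recovers the convergence of the vector-valued integrals over a set.
\<close>

lemma Linf_weak_star_conv_set_integral: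
  fixes v :: "real \<Rightarrow> 'e::euclidean_space"
  assumes conv: "Linf_weak_star_conv a b u v" and P: "P \<in> sets (lebesgue_on {a<..<b})"
    and int: "\<And>j. integrable (lebesgue_on {a<..<b}) (u j)" "integrable (lebesgue_on {a<..<b}) v"
  shows "(\<lambda>j. LINT x|lebesgue_on {a<..<b}. indicator P x *\<^sub>R u j x)
    \<longlonglongrightarrow> (LINT x|lebesgue_on {a<..<b}. indicator P x *\<^sub>R v x)"
proof (subst tendsto_componentwise_iff, intro ballI)
  fix i :: 'e assume "i \<in> Basis"
  interpret finite_measure "lebesgue_on {a<..<b}" by (rule finite_measure_lebesgue_interval)
  have comp: "(LINT x|lebesgue_on {a<..<b}. w x \<bullet> (indicator P x *\<^sub>R i))
      = (LINT x|lebesgue_on {a<..<b}. indicator P x *\<^sub>R w x) \<bullet> i"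
    if "integrable (lebesgue_on {a<..<b}) w" for w :: "real \<Rightarrow> 'e"
  proof -
    have "integrable (lebesgue_on {a<..<b}) (\<lambda>x. indicator P x *\<^sub>R w x)"
      using that P by (intro integrable_mult_indicator)
    from integral_inner_left[OF this, of i] show ?thesis by simp
  qed
  have "integrable (lebesgue_on {a<..<b}) (\<lambda>x. indicator P x *\<^sub>R i)"
    using P by (intro integrable_mult_indicator) simp_all
  with conv have "(\<lambda>j. LINT x|lebesgue_on {a<..<b}. u j x \<bullet> (indicator P x *\<^sub>R i))
    \<longlonglongrightarrow> (LINT x|lebesgue_on {a<..<b}. v x \<bullet> (indicator P x *\<^sub>R i))"
    unfolding Linf_weak_star_conv_def by blast
  then show "(\<lambda>j. (LINT x|lebesgue_on {a<..<b}. indicator P x *\<^sub>R u j x) \<bullet> i)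
    \<longlonglongrightarrow> (LINT x|lebesgue_on {a<..<b}. indicator P x *\<^sub>R v x) \<bullet> i"
    by (simp only: comp int)
qed

text \<open>
  The nonlocal constraint survives weak* limits if \<open>E\<close> is closed and Cartesian convex, since it
  can be expressed by pairs of averages over arbitrary sets, which are continuous under weak*
  convergence. It is enough that the constraint holds for infinitely many indices, which
  spares the passage to a subsequence when a lower limit is estimated.
\<close>

lemma essential_range_square_weak_star_limit:
  fixes v :: "real \<Rightarrow> 'e::euclidean_space"
  assumes conv: "Linf_weak_star_conv a b u v" and E: "closed E" "cartesian_convex E"
    and u: "\<And>j. integrable (lebesgue_on {a<..<b}) (u j)" and v: "integrable (lebesgue_on {a<..<b}) v"
    and freq: "\<exists>\<^sub>F j in sequentially. AE p in lebesgue_on ({a<..<b} \<times> {a<..<b}). (u j (fst p), u j (snd p)) \<in> E"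
  shows "essential_range (lebesgue_on {a<..<b}) v \<times> essential_range (lebesgue_on {a<..<b}) v \<subseteq> E"
proof clarify
  let ?M = "lebesgue_on {a<..<b}"
  let ?R = "essential_range ?M"
  interpret finite_measure ?M by (rule finite_measure_lebesgue_interval)
  fix \<xi> \<eta> assume r: "\<xi> \<in> ?R v" "\<eta> \<in> ?R v"
  \<comment> \<open>averages over \<open>P\<close>, and the sets where \<open>v\<close> is within \<open>e\<close> of a given point\<close>
  define m where "m P w = (LINT x|?M. indicator P x *\<^sub>R w x) /\<^sub>R measure ?M P" for P and w :: "real \<Rightarrow> 'e"
  define B where "B e \<zeta> = v -` ball \<zeta> e \<inter> space ?M" for e \<zeta>
  have B: "B e \<zeta> \<in> sets ?M" for e \<zeta>
    unfolding B_def using v by (intro measurable_sets[of v _ borel]) auto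
  have pos: "measure ?M (B e \<zeta>) > 0" if "\<zeta> \<in> ?R v" "e > 0" for e \<zeta>
  proof (rule ccontr)
    assume "\<not> ?thesis"
    then have "measure ?M (B e \<zeta>) = 0" using measure_nonneg[of ?M "B e \<zeta>"] by linarith
    then have "B e \<zeta> \<in> null_sets ?M" using B by (simp add: emeasure_eq_measure null_setsI)
    from AE_not_in[OF this] have "AE x in ?M. v x \<notin> ball \<zeta> e"
      by (rule AE_mp) (auto simp: B_def)
    moreover have "open (ball \<zeta> e)" "\<zeta> \<in> ball \<zeta> e" using that by auto
    ultimately show False using that(1) unfolding essential_range_def by blast
  qed
  have near: "m (B e \<zeta>) v \<in> cball \<zeta> e" if "\<zeta> \<in> ?R v" "e > 0" for e \<zeta>
    unfolding m_def
    by (rule average_in_closed_convex[OF v B pos[OF that]]) (auto simp: B_def emeasure_eq_measure)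
  have lim: "(m (B e \<xi>) v, m (B e \<eta>) v) \<in> E" if e: "e > 0" for e
  proof (rule ccontr)
    assume notE: "(m (B e \<xi>) v, m (B e \<eta>) v) \<notin> E"
    have "(\<lambda>j. (m (B e \<xi>) (u j), m (B e \<eta>) (u j))) \<longlonglongrightarrow> (m (B e \<xi>) v, m (B e \<eta>) v)"
      unfolding m_def
      by (intro tendsto_Pair tendsto_scaleR tendsto_const Linf_weak_star_conv_set_integral conv B u v)
    then have "\<forall>\<^sub>F j in sequentially. (m (B e \<xi>) (u j), m (B e \<eta>) (u j)) \<in> - E"
      by (rule topological_tendstoD) (use E notE in auto)
    from frequently_ex[OF frequently_eventually_conj[OF freq this]] obtain j where
      ae: "AE p in lebesgue_on ({a<..<b} \<times> {a<..<b}). (u j (fst p), u j (snd p)) \<in> E"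
      and j: "(m (B e \<xi>) (u j), m (B e \<eta>) (u j)) \<in> - E"
      by blast
    \<comment> \<open>pairs of averages of \<open>u j\<close> lie in \<open>K \<times> K \<subseteq> E\<close>, against the choice of \<open>j\<close>\<close>
    define K where "K = closure (convex hull (?R (u j)))"
    have "AE x in ?M. AE y in ?M. (u j x, u j y) \<in> E"
      using AE_lebesgue_square_slices[OF _ ae] by simp
    then have "?R (u j) \<times> ?R (u j) \<subseteq> E"
      by (rule essential_range_square_subset[OF E(1)])
    then have "(convex hull (?R (u j))) \<times> (convex hull (?R (u j))) \<subseteq> E"
      using E(2) by (auto simp: cartesian_convex_def)
    then have K: "K \<times> K \<subseteq> E"
      unfolding K_def closure_Times[symmetric] using E(1) by (rule closure_minimal)
    have "?R (u j) \<subseteq> K"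
      unfolding K_def by (rule order_trans[OF hull_subset closure_subset])
    then have "AE x in ?M. x \<in> B e \<zeta> \<longrightarrow> u j x \<in> K" for \<zeta>
      by (intro eventually_mono[OF AE_in_essential_range[of "u j" ?M]]) (auto simp: subset_iff)
    then have "m (B e \<zeta>) (u j) \<in> K" if "\<zeta> \<in> ?R v" for \<zeta>
      unfolding m_def
      by (intro average_in_closed_convex[OF u B pos[OF that e]])
        (auto simp: emeasure_eq_measure K_def convex_closure)
    then show False using j K r by auto
  qed
  show "(\<xi>, \<eta>) \<in> E"
  proof (rule Lim_in_closed_set[OF E(1) _ sequentially_bot])
    let ?e = "\<lambda>n. inverse (real (Suc n))"
    show "\<forall>\<^sub>F n in sequentially. (m (B (?e n) \<xi>) v, m (B (?e n) \<eta>) v) \<in> E"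
      by (intro always_eventually allI lim) simp
    have "(\<lambda>n. m (B (?e n) \<zeta>) v) \<longlonglongrightarrow> \<zeta>" if "\<zeta> \<in> ?R v" for \<zeta>
    proof (rule metric_tendsto_imp_tendsto[OF LIMSEQ_inverse_real_of_nat], intro always_eventually allI)
      fix n
      show "dist (m (B (?e n) \<zeta>) v) \<zeta> \<le> dist (?e n) 0"
        using near[OF that, of "?e n"] by (simp add: dist_commute)
    qed
    then show "(\<lambda>n. (m (B (?e n) \<xi>) v, m (B (?e n) \<eta>) v)) \<longlonglongrightarrow> (\<xi>, \<eta>)"
      using r by (intro tendsto_Pair)
  qed
qed

lemma weak_star_lsc_of_cartesian_level_convex:
  fixes W :: "'e::euclidean_space \<times> 'e \<Rightarrow> real"
  assumes W: "lower_semicontinuous W" and C: "cartesian_level_convex W"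
  shows "seq_weak_star_lsc a b (J a b W)"
  unfolding seq_weak_star_lsc_def
proof (intro allI impI)
  fix u and v :: "real \<Rightarrow> 'e"
  assume *: "(\<forall>j. u j \<in> W1inf a b) \<and> v \<in> W1inf a b \<and> W1inf_weak_star_conv a b u v"
  let ?M = "lebesgue_on {a<..<b}"
  have int: "integrable ?M (weak_deriv a b (u j))" "integrable ?M (weak_deriv a b v)" for j
    using * by (auto intro!: integrable_Linf weak_deriv_works)
  show "J a b W v \<le> liminf (\<lambda>j. J a b W (u j))"
  proof (rule ccontr)
    assume "\<not> ?thesis"
    then obtain c where c: "liminf (\<lambda>j. J a b W (u j)) < ereal c" "ereal c < J a b W v"
      using ereal_dense2[of "liminf (\<lambda>j. J a b W (u j))" "J a b W v"] by (auto simp: not_le)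
    have "\<exists>\<^sub>F j in sequentially. J a b W (u j) \<le> ereal c"
    proof (rule ccontr)
      assume "\<not> ?thesis"
      then have "\<forall>\<^sub>F j in sequentially. ereal c \<le> J a b W (u j)"
        by (auto simp: not_frequently elim!: eventually_mono)
      then have "ereal c \<le> liminf (\<lambda>j. J a b W (u j))" by (rule Liminf_bounded)
      with c(1) show False by simp
    qed
    then have freq: "\<exists>\<^sub>F j in sequentially. AE p in lebesgue_on ({a<..<b} \<times> {a<..<b}).
        (weak_deriv a b (u j) (fst p), weak_deriv a b (u j) (snd p)) \<in> sublevel W c"
      by (simp add: J_le_iff_AE[OF borel_measurable_integrable[OF int(1)] W])
    have range: "AE p in lebesgue_on ({a<..<b} \<times> {a<..<b}).
        weak_deriv a b v (fst p) \<in> essential_range ?M (weak_deriv a b v) \<and>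
        weak_deriv a b v (snd p) \<in> essential_range ?M (weak_deriv a b v)"
      by (rule AE_lebesgue_square_coordinates) (simp_all add: AE_in_essential_range)
    have sub: "essential_range ?M (weak_deriv a b v) \<times> essential_range ?M (weak_deriv a b v)
        \<subseteq> sublevel W c"
      using * C by (intro essential_range_square_weak_star_limit[OF _ closed_sublevel[OF W] _ int freq])
        (auto simp: W1inf_weak_star_conv_def cartesian_level_convex_def)
    from range have "AE p in lebesgue_on ({a<..<b} \<times> {a<..<b}).
        (weak_deriv a b v (fst p), weak_deriv a b v (snd p)) \<in> sublevel W c"
      by (rule eventually_mono) (use sub in blast)
    then have "J a b W v \<le> ereal c"
      by (simp add: J_le_iff_AE[OF borel_measurable_integrable[OF int(2)] W])
    with c(2) show False by simp
  qed
qed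

section \<open>A criterion for weak* convergence to zero\<close>

text \<open>
  The sets over which the integrals tend to zero form a Dynkin class: a uniform bound makes the
  integral over a set of small measure uniformly small, which handles countable disjoint unions.
  This class contains all open intervals, where those reaching the end points of \<open>(a, b)\<close> are
  approximated from inside, hence all Borel sets, hence up to null sets all Lebesgue sets.
\<close>

lemma set_integrals_tendsto_zero:
  fixes s :: "nat \<Rightarrow> real \<Rightarrow> 'e::euclidean_space"
  assumes ab: "a < b"
    and meas: "\<And>j. s j \<in> borel_measurable (lebesgue_on {a<..<b})"
    and bound: "\<And>j. AE x in lebesgue_on {a<..<b}. norm (s j x) \<le> C"
    and intervals: "\<And>\<alpha> \<beta>. a < \<alpha> \<Longrightarrow> \<alpha> < \<beta> \<Longrightarrow> \<beta> < b \<Longrightarrow>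
      (\<lambda>j. LINT x|lebesgue_on {a<..<b}. indicator {\<alpha><..<\<beta>} x *\<^sub>R s j x) \<longlonglongrightarrow> 0"
    and B: "B \<in> sets (lebesgue_on {a<..<b})"
  shows "(\<lambda>j. LINT x|lebesgue_on {a<..<b}. indicator B x *\<^sub>R s j x) \<longlonglongrightarrow> 0"
proof -
  let ?M = "lebesgue_on {a<..<b}"
  interpret finite_measure ?M by (rule finite_measure_lebesgue_interval)
  define I where "I A j = (LINT x|?M. indicator A x *\<^sub>R s j x)" for A j
  define C' where "C' = max C 0"
  have bound': "AE x in ?M. norm (s j x) \<le> C'" for j
    using bound[of j] by eventually_elim (simp add: C'_def)
  have C': "C' \<ge> 0" by (simp add: C'_def)
  have int: "integrable ?M (s j)" for j
    using bound' meas by (rule integrable_const_bound)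
  have intA: "integrable ?M (\<lambda>x. indicator A x *\<^sub>R s j x)" if "A \<in> sets ?M" for A j
    using that int by (rule integrable_mult_indicator)
  have I_le: "norm (I A j) \<le> C' * measure ?M A" if A: "A \<in> sets ?M" for A j
  proof -
    have "norm (I A j) \<le> (LINT x|?M. norm (indicator A x *\<^sub>R s j x))"
      unfolding I_def by (rule integral_norm_bound)
    also have "\<dots> \<le> (LINT x|?M. C' * indicator A x)"
    proof (rule integral_mono_AE)
      show "integrable ?M (\<lambda>x. norm (indicator A x *\<^sub>R s j x))"
        using intA[OF A] by (rule integrable_norm)
      show "integrable ?M (\<lambda>x. C' * indicator A x)"
        using A by (intro integrable_mult_right integrable_real_indicator) (auto simp: emeasure_eq_measure)
      show "AE x in ?M. norm (indicator A x *\<^sub>R s j x) \<le> C' * indicator A x"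
        using bound'[of j] by eventually_elim (auto simp: indicator_def)
    qed
    also have "\<dots> = C' * measure ?M A"
      using A sets.sets_into_space[OF A] by (simp add: Int_absorb2)
    finally show ?thesis .
  qed
  have Int_add: "I (A \<union> A') j = I A j + I A' j"
    if "A \<in> sets ?M" "A' \<in> sets ?M" "A \<inter> A' = {}" for A A' j
  proof -
    have "indicator (A \<union> A') x *\<^sub>R s j x = indicator A x *\<^sub>R s j x + indicator A' x *\<^sub>R s j x" for x
      using that(3) by (auto simp: indicator_def)
    then show ?thesis unfolding I_def using intA that by simp
  qed
  have I_empty: "I {} = (\<lambda>_. 0)" by (simp add: I_def fun_eq_iff)
  \<comment> \<open>closure under approximation from inside in measure, used for intervals and for disjoint unions\<close>
  have approx: "I A \<longlonglongrightarrow> 0"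
    if A: "A \<in> sets ?M" and ex: "\<And>e. e > 0 \<Longrightarrow> \<exists>A'\<in>sets ?M. A' \<subseteq> A \<and> measure ?M (A - A') \<le> e \<and> I A' \<longlonglongrightarrow> 0"
    for A
  proof (rule LIMSEQ_I)
    fix r :: real assume r: "r > 0"
    define e where "e = r / (2 * (C' + 1))"
    have e: "e > 0" using r C' by (auto simp: e_def)
    have Ce: "C' * e \<le> r / 2" using r C' by (simp add: e_def field_simps)
    from ex[OF e] obtain A' where A': "A' \<in> sets ?M" "A' \<subseteq> A" "measure ?M (A - A') \<le> e" "I A' \<longlonglongrightarrow> 0"
      by blast
    from LIMSEQ_D[OF A'(4), of "r/2"] r obtain N where N: "\<And>n. n \<ge> N \<Longrightarrow> norm (I A' n) < r / 2"
      by auto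
    have "norm (I A n) < r" if "n \<ge> N" for n
    proof -
      have "I A n = I A' n + I (A - A') n"
        using Int_add[of A' "A - A'" n] A' A by (simp add: Un_absorb1)
      then have "norm (I A n) \<le> norm (I A' n) + norm (I (A - A') n)"
        by (simp add: norm_triangle_ineq)
      also have "norm (I (A - A') n) \<le> C' * e"
        using I_le[of "A - A'" n] A A' C' by (meson mult_left_mono order_trans sets.Diff)
      finally show ?thesis using N[OF that] Ce by linarith
    qed
    then show "\<exists>N. \<forall>n\<ge>N. norm (I A n - 0) < r" by auto
  qed
  have subI: "{\<alpha><..<\<beta>} \<inter> {a<..<b} \<in> sets ?M" for \<alpha> \<beta> :: real
    by (auto simp: sets_restrict_space_iff)
  have whole: "I ({\<alpha><..<\<beta>} \<inter> {a<..<b}) \<longlonglongrightarrow> 0" for \<alpha> \<beta>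
  proof (rule approx[OF subI])
    fix e :: real assume e: "e > 0"
    define l u where "l = max \<alpha> a" and "u = min \<beta> b"
    have eq: "{\<alpha><..<\<beta>} \<inter> {a<..<b} = {l<..<u}" by (auto simp: l_def u_def)
    show "\<exists>A'\<in>sets ?M. A' \<subseteq> {\<alpha><..<\<beta>} \<inter> {a<..<b} \<and>
        measure ?M ({\<alpha><..<\<beta>} \<inter> {a<..<b} - A') \<le> e \<and> I A' \<longlonglongrightarrow> 0"
    proof (cases "l < u")
      case False
      then have "{\<alpha><..<\<beta>} \<inter> {a<..<b} = {}" using eq by simp
      then show ?thesis unfolding \<open>_ = {}\<close> using e by (intro bexI[of _ "{}"]) (simp_all add: I_empty)
    next
      case True
      define h where "h = min (e / 2) ((u - l) / 4)"
      have "h > 0" using e True by (simp add: h_def)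
      moreover have "h \<le> e / 2" "h \<le> (u - l) / 4"
        by (simp_all only: h_def min.cobounded1 min.cobounded2)
      ultimately have h: "h > 0" "h \<le> e / 2" "h \<le> (u - l) / 4" .
      have lu: "a \<le> l" "u \<le> b" by (auto simp: l_def u_def)
      have sub: "{l + h<..<u - h} \<subseteq> {l<..<u}" using h by auto
      have dsub: "{l<..<u} - {l + h<..<u - h} = {l<..l + h} \<union> {u - h..<u}" using h by auto
      have "measure ?M ({l<..<u} - {l + h<..<u - h}) = measure lebesgue ({l<..l + h} \<union> {u - h..<u})"
        unfolding dsub using lu h by (intro measure_restrict_space) auto
      also have "\<dots> \<le> measure lebesgue {l<..l + h} + measure lebesgue {u - h..<u}"
        using h(1) by (intro measure_subadditive) auto
      also have "\<dots> \<le> e" using h by simp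
      finally have "measure ?M ({l<..<u} - {l + h<..<u - h}) \<le> e" .
      moreover have "I {l + h<..<u - h} \<longlonglongrightarrow> 0"
        unfolding I_def using h lu True by (intro intervals) auto
      moreover have "{l + h<..<u - h} \<in> sets ?M"
        using sub lu by (auto simp: sets_restrict_space_iff)
      ultimately show ?thesis unfolding eq using sub by (intro bexI[of _ "{l + h<..<u - h}"]) auto
    qed
  qed
  have borel: "I (A \<inter> {a<..<b}) \<longlonglongrightarrow> 0" if "A \<in> sets borel" for A :: "real set"
  proof -
    let ?P = "\<lambda>A. I (A \<inter> {a<..<b}) \<longlonglongrightarrow> 0"
    have sets: "A \<inter> {a<..<b} \<in> sets ?M" if "A \<in> sigma_sets UNIV (range (\<lambda>(a, b). box a b :: real set))" for A :: "real set"
    proof -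
      have "A \<in> sets borel" using that unfolding borel_eq_box by (simp del: box_real)
      then show ?thesis by (auto simp: sets_restrict_space_iff)
    qed
    have "Int_stable (range (\<lambda>(a, b). box a b :: real set))"
      by (auto simp: Int_stable_def box_Int_box)
    moreover have "range (\<lambda>(a, b). box a b :: real set) \<subseteq> Pow UNIV" by simp
    moreover have "A \<in> sigma_sets UNIV (range (\<lambda>(a, b). box a b :: real set))"
      using that unfolding borel_eq_box by (simp del: box_real)
    ultimately show "?P A"
    proof (induction A rule: sigma_sets_induct_disjoint)
      case (basic A)
      then show ?case using whole by auto
    next
      case empty
      then show ?case by (simp add: I_empty)
    next
      case (compl A)
      have "I ((UNIV - A) \<inter> {a<..<b}) j = I {a<..<b} j - I (A \<inter> {a<..<b}) j" for j
      proof -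
        have d: "(UNIV - A) \<inter> {a<..<b} = {a<..<b} - A \<inter> {a<..<b}" by auto
        have "I (A \<inter> {a<..<b} \<union> ({a<..<b} - A \<inter> {a<..<b})) j
          = I (A \<inter> {a<..<b}) j + I ({a<..<b} - A \<inter> {a<..<b}) j"
          using sets[OF compl.hyps] sets.top[of ?M] by (intro Int_add sets.Diff) auto
        then show ?thesis unfolding d by (simp add: Un_absorb1)
      qed
      moreover have "(\<lambda>j. I {a<..<b} j - I (A \<inter> {a<..<b}) j) \<longlonglongrightarrow> 0"
        using tendsto_diff[OF whole[of a b] compl.IH] by simp
      ultimately show ?case by simp
    next
      case (union A)
      have setsA: "A i \<inter> {a<..<b} \<in> sets ?M" for i
        using union.hyps(2) by (intro sets) blast
      define F where "F n = (\<Union>i<n. A i \<inter> {a<..<b})" for n :: nat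
      have F: "F n \<in> sets ?M" for n unfolding F_def by (intro sets.finite_UN setsA) simp
      have IF: "I (F n) \<longlonglongrightarrow> 0" for n
      proof (induction n)
        case 0
        show ?case by (simp add: F_def I_empty)
      next
        case (Suc n)
        have "I (F (Suc n)) j = I (F n) j + I (A n \<inter> {a<..<b}) j" for j
        proof -
          have "F (Suc n) = F n \<union> (A n \<inter> {a<..<b})" by (auto simp: F_def lessThan_Suc)
          moreover have "A i \<inter> A n = {}" if "i < n" for i
            using union.hyps(1) that by (simp add: disjoint_family_on_def)
          then have "F n \<inter> (A n \<inter> {a<..<b}) = {}" unfolding F_def by blast
          ultimately show ?thesis using Int_add[OF F[of n] setsA[of n]] by simp
        qed
        then show ?case using tendsto_add[OF Suc union.IH[of n]] by simp
      qed
      let ?U = "(\<Union>i. A i) \<inter> {a<..<b}"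
      have U: "?U = (\<Union>n. F n)"
      proof (intro equalityI subsetI)
        fix x assume "x \<in> ?U"
        then obtain i where "x \<in> A i \<inter> {a<..<b}" by blast
        then have "x \<in> F (Suc i)" by (auto simp: F_def)
        then show "x \<in> (\<Union>n. F n)" by blast
      qed (auto simp: F_def)
      have "(\<lambda>n. measure ?M (F n)) \<longlonglongrightarrow> measure ?M (\<Union>n. F n)"
      proof (rule finite_Lim_measure_incseq)
        show "range F \<subseteq> sets ?M" using F by blast
        show "incseq F" unfolding incseq_def F_def by (intro allI impI UN_mono) auto
      qed
      then have lim: "(\<lambda>n. measure ?M (F n)) \<longlonglongrightarrow> measure ?M ?U" by (simp only: U)
      have setsU: "?U \<in> sets ?M" unfolding U using F by blast
      show ?case
      proof (rule approx[OF setsU])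
        fix e :: real assume "e > 0"
        with LIMSEQ_D[OF lim] obtain n where n: "norm (measure ?M (F n) - measure ?M ?U) < e" by blast
        have sub: "F n \<subseteq> ?U" by (auto simp: F_def)
        have "measure ?M (?U - F n) = measure ?M ?U - measure ?M (F n)"
          by (rule finite_measure_Diff[OF setsU F sub])
        then have "measure ?M (?U - F n) \<le> e" using n by simp
        then show "\<exists>A'\<in>sets ?M. A' \<subseteq> ?U \<and> measure ?M (?U - A') \<le> e \<and> I A' \<longlonglongrightarrow> 0"
          using F[of n] sub IF[of n] by blast
      qed
    qed
  qed
  \<comment> \<open>a Lebesgue set differs from a Borel set by a null set\<close>
  have "B \<in> sets lebesgue" "B \<subseteq> {a<..<b}"
    using B by (auto simp: sets_restrict_space_iff)
  from sets_completionE[OF this(1)] obtain S N N' where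
    S: "B = S \<union> N" "N \<subseteq> N'" "N' \<in> null_sets lborel" "S \<in> sets lborel" by metis
  have Sab: "S \<inter> {a<..<b} = S" using S(1) \<open>B \<subseteq> {a<..<b}\<close> by auto
  have S': "S \<in> sets ?M" using S(4) Sab by (auto simp: sets_restrict_space_iff)
  have "AE x in lborel. x \<notin> N'" using S(3) by (rule AE_not_in)
  then have "AE x in ?M. x \<notin> N'"
    by (simp add: AE_restrict_space_iff AE_completion_iff) (auto elim: eventually_mono)
  then have ae: "AE x in ?M. indicator B x *\<^sub>R s j x = indicator S x *\<^sub>R s j x" for j
    by eventually_elim (use S(1,2) in \<open>auto simp: indicator_def\<close>)
  have "I B j = I S j" for j
    unfolding I_def by (intro integral_cong_AE ae) (use intA[OF B] intA[OF S'] in auto)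
  moreover have "I S \<longlonglongrightarrow> 0" using borel[of S] S(4) Sab by simp
  ultimately show ?thesis unfolding I_def by simp
qed

text \<open>
  Simple functions are dense in \<open>L\<^sup>1\<close> and the sequence is bounded in \<open>L\<^sup>\<infinity>\<close>, so the
  convergence on indicators extends to all integrable test functions.
\<close>

lemma weak_star_zero_of_interval_integrals:
  fixes s :: "nat \<Rightarrow> real \<Rightarrow> 'e::euclidean_space"
  assumes ab: "a < b"
    and meas: "\<And>j. s j \<in> borel_measurable (lebesgue_on {a<..<b})"
    and bound: "\<And>j. AE x in lebesgue_on {a<..<b}. norm (s j x) \<le> C"
    and intervals: "\<And>\<alpha> \<beta>. a < \<alpha> \<Longrightarrow> \<alpha> < \<beta> \<Longrightarrow> \<beta> < b \<Longrightarrow>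
      (\<lambda>j. LINT x|lebesgue_on {a<..<b}. indicator {\<alpha><..<\<beta>} x *\<^sub>R s j x) \<longlonglongrightarrow> 0"
    and g: "integrable (lebesgue_on {a<..<b}) g"
  shows "(\<lambda>j. LINT x|lebesgue_on {a<..<b}. s j x \<bullet> g x) \<longlonglongrightarrow> 0"
proof -
  let ?M = "lebesgue_on {a<..<b}"
  interpret finite_measure ?M by (rule finite_measure_lebesgue_interval)
  define C' where "C' = max C 0"
  have bound': "AE x in ?M. norm (s j x) \<le> C'" for j
    using bound[of j] by eventually_elim (simp add: C'_def)
  have C': "C' \<ge> 0" by (simp add: C'_def)
  have int: "integrable ?M (s j)" for j
    using bound' meas by (rule integrable_const_bound)
  have bd: "AE x in ?M. norm (s j x \<bullet> f x) \<le> C' * norm (f x)" for j f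
    using bound'[of j]
  proof eventually_elim
    case (elim x)
    have "\<bar>s j x \<bullet> f x\<bar> \<le> norm (s j x) * norm (f x)" by (rule Cauchy_Schwarz_ineq2)
    also have "\<dots> \<le> C' * norm (f x)" using elim by (rule mult_right_mono) simp
    finally show ?case by simp
  qed
  have intf: "integrable ?M (\<lambda>x. s j x \<bullet> f x)" if f: "integrable ?M f" for f j
  proof (rule Bochner_Integration.integrable_bound)
    show "integrable ?M (\<lambda>x. C' * norm (f x))" using f by simp
    show "(\<lambda>x. s j x \<bullet> f x) \<in> borel_measurable ?M"
      using meas[of j] f by (intro borel_measurable_inner) auto
    show "AE x in ?M. norm (s j x \<bullet> f x) \<le> norm (C' * norm (f x))"
      using bd[of j f] by eventually_elim (use C' in simp)
  qed
  show ?thesis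
    using g
  proof (induction rule: integrable_induct)
    case (base A c)
    have "(LINT x|?M. s j x \<bullet> (indicator A x *\<^sub>R c)) = (LINT x|?M. indicator A x *\<^sub>R s j x) \<bullet> c" for j
    proof -
      have "integrable ?M (\<lambda>x. indicator A x *\<^sub>R s j x)"
        using base(1) int by (rule integrable_mult_indicator)
      from integral_inner_left[OF this, of c] show ?thesis by simp
    qed
    moreover have "(\<lambda>j. (LINT x|?M. indicator A x *\<^sub>R s j x) \<bullet> c) \<longlonglongrightarrow> 0 \<bullet> c"
      by (intro tendsto_inner tendsto_const set_integrals_tendsto_zero[OF ab meas bound intervals base(1)])
    ultimately show ?case by (simp only: inner_zero_left)
  next
    case (add f g)
    have "(LINT x|?M. s j x \<bullet> (f x + g x)) = (LINT x|?M. s j x \<bullet> f x) + (LINT x|?M. s j x \<bullet> g x)" for j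
      using intf add.hyps by (simp add: inner_add_right)
    then show ?case using tendsto_add[OF add.IH] by simp
  next
    case (lim f r)
    have L1: "(\<lambda>i. LINT x|?M. norm (r i x - f x)) \<longlonglongrightarrow> (LINT x|?M. 0)"
    proof (rule integral_dominated_convergence)
      show "integrable ?M (\<lambda>x. 3 * norm (f x))" using lim.hyps by simp
      show "AE x in ?M. (\<lambda>i. norm (r i x - f x)) \<longlonglongrightarrow> 0"
        using lim.hyps(2) by (intro AE_I2 tendsto_norm_zero LIM_zero)
      show "AE x in ?M. norm (norm (r i x - f x)) \<le> 3 * norm (f x)" for i
      proof (rule AE_I2)
        fix x assume "x \<in> space ?M"
        from lim.hyps(3)[OF this, of i] show "norm (norm (r i x - f x)) \<le> 3 * norm (f x)"
          using norm_triangle_ineq4[of "r i x" "f x"] by simp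
      qed
    qed (use lim.hyps in auto)
    show ?case
    proof (rule LIMSEQ_I)
      fix e :: real assume e: "e > 0"
      have "e / (2 * (C' + 1)) > 0" using e C' by simp
      from LIMSEQ_D[OF L1 this] obtain i where
        "norm ((LINT x|?M. norm (r i x - f x)) - (LINT x|?M. 0)) < e / (2 * (C' + 1))" by blast
      then have i: "(LINT x|?M. norm (r i x - f x)) < e / (2 * (C' + 1))" by simp
      have Ci: "C' * (LINT x|?M. norm (r i x - f x)) \<le> e / 2"
      proof -
        have "C' * (LINT x|?M. norm (r i x - f x)) \<le> C' * (e / (2 * (C' + 1)))"
          using i C' by (intro mult_left_mono) auto
        also have "\<dots> \<le> e / 2" using e C' by (simp add: field_simps)
        finally show ?thesis .
      qed
      from LIMSEQ_D[OF lim.IH[of i], of "e/2"] e obtain N where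
        N: "\<And>n. n \<ge> N \<Longrightarrow> norm (LINT x|?M. s n x \<bullet> r i x) < e / 2" by auto
      have "norm (LINT x|?M. s n x \<bullet> f x) < e" if "n \<ge> N" for n
      proof -
        have irf: "integrable ?M (\<lambda>x. r i x - f x)" using lim.hyps by simp
        have split: "(LINT x|?M. s n x \<bullet> f x) = (LINT x|?M. s n x \<bullet> r i x) - (LINT x|?M. s n x \<bullet> (r i x - f x))"
          using intf[OF lim.hyps(1), of n i] intf[OF lim.hyps(4), of n]
          by (simp add: inner_diff_right)
        have "norm (LINT x|?M. s n x \<bullet> (r i x - f x)) \<le> C' * (LINT x|?M. norm (r i x - f x))"
        proof -
          have "norm (LINT x|?M. s n x \<bullet> (r i x - f x)) \<le> (LINT x|?M. norm (s n x \<bullet> (r i x - f x)))"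
            by (rule integral_norm_bound)
          also have "\<dots> \<le> (LINT x|?M. C' * norm (r i x - f x))"
            by (intro integral_mono_AE bd integrable_norm intf irf integrable_mult_right)
          finally show ?thesis by simp
        qed
        then show ?thesis
          unfolding split using N[OF that] Ci
            norm_triangle_ineq4[of "LINT x|?M. s n x \<bullet> r i x" "LINT x|?M. s n x \<bullet> (r i x - f x)"]
          by linarith
      qed
      then show "\<exists>N. \<forall>n\<ge>N. norm ((LINT x|?M. s n x \<bullet> f x) - 0) < e" by auto
    qed
  qed
qed

section \<open>Test functions and uniqueness of the weak derivative\<close>

text \<open>
  With \<open>r = 1 / ((x - \<alpha>) (\<beta> - x))\<close>, the function \<open>exp (- \<epsilon> r)\<close> on \<open>(\<alpha>, \<beta>)\<close>, extended by zero, is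
  a smooth bump. The factors \<open>p(x) r^k\<close> are included because
  \<open>r' = - (\<alpha> + \<beta> - 2 x) r\<^sup>2\<close>: the sums of such terms are closed under differentiation, so that
  smoothness reduces to differentiability of a single term.
\<close>

definition bump_term :: "real \<Rightarrow> real \<Rightarrow> real \<Rightarrow> real poly \<Rightarrow> nat \<Rightarrow> real \<Rightarrow> real" where
  "bump_term \<alpha> \<beta> \<epsilon> p k x = (if \<alpha> < x \<and> x < \<beta> then
     poly p x * inverse ((x - \<alpha>) * (\<beta> - x)) ^ k * exp (- \<epsilon> * inverse ((x - \<alpha>) * (\<beta> - x))) else 0)"

lemma power_times_exp_neg_le:
  fixes x :: real
  assumes "x \<ge> 0" "n > 0"
  shows "x ^ n * exp (- x) \<le> real n ^ n"
proof -
  have "x / real n \<le> exp (x / real n)"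
    using exp_ge_add_one_self[of "x / real n"] by linarith
  then have "(x / real n) ^ n \<le> exp (x / real n) ^ n"
    using assms by (intro power_mono) auto
  also have "exp (x / real n) ^ n = exp x"
    using assms by (simp flip: exp_of_nat_mult)
  finally have "x ^ n \<le> exp x * real n ^ n"
    using assms by (simp add: power_divide divide_simps)
  then show ?thesis by (simp add: exp_minus divide_simps mult.commute)
qed

lemma has_derivative_zero_of_quadratic_bound:
  fixes f :: "real \<Rightarrow> real"
  assumes "\<And>y. \<bar>f y\<bar> \<le> K * (y - x)\<^sup>2"
  shows "(f has_real_derivative 0) (at x)"
proof -
  have fx: "f x = 0" using assms[of x] by simp
  have "((\<lambda>y. (f y - f x) / (y - x)) \<longlongrightarrow> 0) (at x)"
  proof (rule Lim_null_comparison)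
    show "\<forall>\<^sub>F y in at x. norm ((f y - f x) / (y - x)) \<le> K * \<bar>y - x\<bar>"
      unfolding eventually_at_filter
    proof (intro always_eventually allI impI)
      fix y assume "y \<noteq> x"
      then show "norm ((f y - f x) / (y - x)) \<le> K * \<bar>y - x\<bar>"
        using assms[of y] by (simp add: fx divide_simps power2_eq_square abs_mult_self_eq mult.assoc)
    qed
    have "((\<lambda>y. K * \<bar>y - x\<bar>) \<longlongrightarrow> K * \<bar>x - x\<bar>) (at x)"
      by (intro tendsto_intros)
    then show "((\<lambda>y. K * \<bar>y - x\<bar>) \<longlongrightarrow> 0) (at x)" by simp
  qed
  then show ?thesis by (simp add: has_field_derivative_iff)
qed

text \<open>
  Near and beyond the end points, where differentiability is not clear from the formula, the decay
  of the exponential beats any power of \<open>r\<close>; bounding \<open>r^(k + 2) exp (- \<epsilon> r)\<close> leaves a factor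
  \<open>1 / r\<^sup>2\<close>, which is at most quadratic in the distance to \<open>x\<close>.
\<close>

lemma bump_term_quadratic_bound:
  assumes \<epsilon>: "\<epsilon> > 0" and x: "x \<le> \<alpha> \<or> \<beta> \<le> x"
  shows "\<exists>K. \<forall>y. \<bar>bump_term \<alpha> \<beta> \<epsilon> p k y\<bar> \<le> K * (y - x)\<^sup>2"
proof -
  have "compact (poly p ` {\<alpha>..\<beta>})"
    by (intro compact_continuous_image continuous_intros compact_Icc)
  then obtain P0 where "\<And>z. z \<in> poly p ` {\<alpha>..\<beta>} \<Longrightarrow> norm z \<le> P0"
    using compact_imp_bounded[of "poly p ` {\<alpha>..\<beta>}"] unfolding bounded_iff by auto
  then have P0: "\<bar>poly p y\<bar> \<le> P0" if "\<alpha> < y" "y < \<beta>" for y using that by force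
  define n where "n = k + 2"
  define C where "C = real n ^ n / \<epsilon> ^ n"
  show ?thesis
  proof (intro exI allI)
    fix y
    show "\<bar>bump_term \<alpha> \<beta> \<epsilon> p k y\<bar> \<le> (\<bar>P0\<bar> * C * (\<beta> - \<alpha>)\<^sup>2) * (y - x)\<^sup>2"
    proof (cases "\<alpha> < y \<and> y < \<beta>")
      case False
      then show ?thesis using \<epsilon> by (auto simp: bump_term_def C_def)
    next
      case True
      define w where "w = (y - \<alpha>) * (\<beta> - y)"
      have w: "w > 0" using True by (simp add: w_def)
      have wle: "w \<le> (\<beta> - \<alpha>) * \<bar>y - x\<bar>"
      proof (cases "x \<le> \<alpha>")
        case True': True
        have "(y - \<alpha>) * (\<beta> - y) \<le> \<bar>y - x\<bar> * (\<beta> - \<alpha>)"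
          using True True' by (intro mult_mono) auto
        then show ?thesis by (simp add: w_def mult.commute)
      next
        case False
        have "(y - \<alpha>) * (\<beta> - y) \<le> (\<beta> - \<alpha>) * \<bar>y - x\<bar>"
          using True False x by (intro mult_mono) auto
        then show ?thesis by (simp add: w_def)
      qed
      have "(\<epsilon> * inverse w) ^ n * exp (- (\<epsilon> * inverse w)) \<le> real n ^ n"
        using \<epsilon> w by (intro power_times_exp_neg_le) (auto simp: n_def)
      then have "inverse w ^ n * exp (- (\<epsilon> * inverse w)) \<le> C"
        using \<epsilon> by (simp add: C_def power_mult_distrib field_simps)
      then have "(inverse w ^ n * exp (- (\<epsilon> * inverse w))) * w\<^sup>2 \<le> C * w\<^sup>2"
        by (rule mult_right_mono) simp
      then have le: "inverse w ^ k * exp (- (\<epsilon> * inverse w)) \<le> C * w\<^sup>2"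
        using w by (simp add: n_def power_add power2_eq_square field_simps)
      have "\<bar>bump_term \<alpha> \<beta> \<epsilon> p k y\<bar> = \<bar>poly p y\<bar> * (inverse w ^ k * exp (- (\<epsilon> * inverse w)))"
        using True w by (simp add: bump_term_def w_def[symmetric] abs_mult power_abs)
      also have "\<dots> \<le> \<bar>P0\<bar> * (C * w\<^sup>2)"
        using P0[of y] True le w by (intro mult_mono[OF _ le]) auto
      also have "\<dots> \<le> \<bar>P0\<bar> * (C * ((\<beta> - \<alpha>) * \<bar>y - x\<bar>)\<^sup>2)"
        using w wle \<epsilon> by (intro mult_left_mono power_mono) (auto simp: C_def)
      finally show ?thesis by (simp add: power_mult_distrib mult.assoc)
    qed
  qed
qed

lemma bump_term_has_derivative:
  assumes \<epsilon>: "\<epsilon> > 0"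
  shows "(bump_term \<alpha> \<beta> \<epsilon> p k has_real_derivative
    (bump_term \<alpha> \<beta> \<epsilon> (pderiv p) k x
     + bump_term \<alpha> \<beta> \<epsilon> (smult (- real k) (p * [:\<alpha> + \<beta>, -2:])) (Suc k) x
     + bump_term \<alpha> \<beta> \<epsilon> (smult \<epsilon> (p * [:\<alpha> + \<beta>, -2:])) (k + 2) x)) (at x)"
proof (cases "\<alpha> < x \<and> x < \<beta>")
  case False
  then have "x \<le> \<alpha> \<or> \<beta> \<le> x" by auto
  from bump_term_quadratic_bound[OF \<epsilon> this] obtain K
    where "\<forall>y. \<bar>bump_term \<alpha> \<beta> \<epsilon> p k y\<bar> \<le> K * (y - x)\<^sup>2" by blast
  then have "(bump_term \<alpha> \<beta> \<epsilon> p k has_real_derivative 0) (at x)"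
    by (intro has_derivative_zero_of_quadratic_bound) auto
  then show ?thesis using False by (auto simp: bump_term_def)
next
  case True
  let ?w = "\<lambda>x. (x - \<alpha>) * (\<beta> - x)"
  have w: "?w x > 0" using True by simp
  define q where "q = poly [:\<alpha> + \<beta>, -2:] x"
  define I where "I = inverse (?w x)"
  define E where "E = exp (- \<epsilon> * I)"
  have dw: "(?w has_real_derivative q) (at x)"
    by (auto intro!: derivative_eq_intros simp: q_def algebra_simps)
  have dI: "((\<lambda>x. inverse (?w x)) has_real_derivative - (I * q * I)) (at x)"
    unfolding I_def by (rule DERIV_inverse'[OF dw less_imp_neq[OF w, symmetric]])
  have dE: "((\<lambda>x. exp (- \<epsilon> * inverse (?w x))) has_real_derivative E * (- \<epsilon> * - (I * q * I))) (at x)"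
    unfolding E_def I_def
    by (rule DERIV_fun_exp DERIV_cmult dI[unfolded I_def])+
  have dP: "((\<lambda>x. inverse (?w x) ^ k) has_real_derivative real k * (I ^ (k - 1) * - (I * q * I))) (at x)"
    using DERIV_power[OF dI, of k] by (simp add: I_def mult.assoc mult.commute mult.left_commute)
  have pw: "real k * (I ^ (k - 1) * - (I * q * I)) = - (real k * q * I ^ Suc k)"
    by (cases k) (simp_all add: algebra_simps)
  let ?h = "\<lambda>x. poly p x * inverse (?w x) ^ k * exp (- \<epsilon> * inverse (?w x))"
  have dh: "(?h has_real_derivative
    (poly (pderiv p) x * I ^ k + - (real k * q * I ^ Suc k) * poly p x) * E
      + E * (- \<epsilon> * - (I * q * I)) * (poly p x * I ^ k)) (at x)"
    using DERIV_mult[OF DERIV_mult[OF poly_DERIV[of p x] dP] dE]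
    by (simp only: pw I_def[symmetric] E_def[symmetric])
  have "(bump_term \<alpha> \<beta> \<epsilon> p k has_real_derivative
    (poly (pderiv p) x * I ^ k + - (real k * q * I ^ Suc k) * poly p x) * E
      + E * (- \<epsilon> * - (I * q * I)) * (poly p x * I ^ k)) (at x)"
    by (rule has_field_derivative_transform_within_open[OF dh, of "{\<alpha><..<\<beta>}"])
      (use True in \<open>auto simp: bump_term_def\<close>)
  moreover have "(poly (pderiv p) x * I ^ k + - (real k * q * I ^ Suc k) * poly p x) * E
      + E * (- \<epsilon> * - (I * q * I)) * (poly p x * I ^ k)
    = bump_term \<alpha> \<beta> \<epsilon> (pderiv p) k x
     + bump_term \<alpha> \<beta> \<epsilon> (smult (- real k) (p * [:\<alpha> + \<beta>, -2:])) (Suc k) x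
     + bump_term \<alpha> \<beta> \<epsilon> (smult \<epsilon> (p * [:\<alpha> + \<beta>, -2:])) (k + 2) x"
    using True
    by (simp only: bump_term_def if_True simp_thms poly_smult poly_mult q_def[symmetric]
        I_def[symmetric] E_def[symmetric] power_add power_Suc power2_eq_square)
      (simp add: algebra_simps)
  ultimately show ?thesis by simp
qed

text \<open>
  A space of functions that contains the bumps and the derivative of each of its members; all its
  members are therefore smooth.
\<close>

inductive bump_span :: "real \<Rightarrow> real \<Rightarrow> real \<Rightarrow> (real \<Rightarrow> real) \<Rightarrow> bool" for \<alpha> \<beta> \<epsilon> where
  "term": "bump_span \<alpha> \<beta> \<epsilon> (bump_term \<alpha> \<beta> \<epsilon> p k)"
| add: "bump_span \<alpha> \<beta> \<epsilon> f \<Longrightarrow> bump_span \<alpha> \<beta> \<epsilon> g \<Longrightarrow> bump_span \<alpha> \<beta> \<epsilon> (\<lambda>x. f x + g x)"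

lemma bump_span_derivative:
  assumes "\<epsilon> > 0" "bump_span \<alpha> \<beta> \<epsilon> f"
  shows "\<exists>g. bump_span \<alpha> \<beta> \<epsilon> g \<and> (\<forall>x. (f has_real_derivative g x) (at x))"
  using assms(2)
proof induction
  case ("term" p k)
  have "bump_span \<alpha> \<beta> \<epsilon> (\<lambda>x. bump_term \<alpha> \<beta> \<epsilon> (pderiv p) k x
     + bump_term \<alpha> \<beta> \<epsilon> (smult (- real k) (p * [:\<alpha> + \<beta>, -2:])) (Suc k) x
     + bump_term \<alpha> \<beta> \<epsilon> (smult \<epsilon> (p * [:\<alpha> + \<beta>, -2:])) (k + 2) x)"
    by (intro bump_span.intros)
  then show ?case using bump_term_has_derivative[OF assms(1)] by blast
next
  case (add f g)
  then obtain f' g' where *: "bump_span \<alpha> \<beta> \<epsilon> f'" "bump_span \<alpha> \<beta> \<epsilon> g'"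
    "\<And>x. (f has_real_derivative f' x) (at x)" "\<And>x. (g has_real_derivative g' x) (at x)" by blast
  then show ?case
    by (intro exI[of _ "\<lambda>x. f' x + g' x"] conjI allI bump_span.add DERIV_add)
qed

lemma bump_span_smooth:
  assumes "\<epsilon> > 0" "bump_span \<alpha> \<beta> \<epsilon> f"
  shows "((deriv ^^ k) f) differentiable (at x)"
proof -
  have "bump_span \<alpha> \<beta> \<epsilon> ((deriv ^^ k) f)"
  proof (induction k)
    case 0
    then show ?case using assms by simp
  next
    case (Suc k)
    from bump_span_derivative[OF assms(1) this] obtain g where
      g: "bump_span \<alpha> \<beta> \<epsilon> g" "\<And>x. ((deriv ^^ k) f has_real_derivative g x) (at x)" by blast
    then have "deriv ((deriv ^^ k) f) = g" by (intro ext DERIV_imp_deriv)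
    then show ?case using g by simp
  qed
  from bump_span_derivative[OF assms(1) this] show ?thesis
    unfolding real_differentiable_def by blast
qed

text \<open>
  As \<open>\<epsilon>\<close> tends to zero, \<open>exp (- \<epsilon> r)\<close> increases to 1 inside the interval.
\<close>

lemma test_function_approximates_interval:
  assumes "a < \<alpha>" "\<alpha> < \<beta>" "\<beta> < b"
  obtains \<phi> :: "nat \<Rightarrow> real \<Rightarrow> real" where
    "\<And>n. test_function a b (\<phi> n)" "\<And>n x. \<bar>\<phi> n x\<bar> \<le> 1"
    "\<And>x. (\<lambda>n. \<phi> n x) \<longlonglongrightarrow> indicator {\<alpha><..<\<beta>} x"
proof
  define \<phi> where "\<phi> n = bump_term \<alpha> \<beta> (inverse (real (Suc n))) 1 0" for n
  have \<phi>: "\<phi> n x = (if \<alpha> < x \<and> x < \<beta> then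
      exp (- inverse (real (Suc n)) * inverse ((x - \<alpha>) * (\<beta> - x))) else 0)" for n x
    by (simp add: \<phi>_def bump_term_def)
  show "test_function a b (\<phi> n)" for n
  proof -
    have smooth: "((deriv ^^ k) (\<phi> n)) differentiable (at x)" for k x
      unfolding \<phi>_def by (rule bump_span_smooth[OF _ bump_span.term]) simp
    have "{x. \<phi> n x \<noteq> 0} = {\<alpha><..<\<beta>}" by (auto simp: \<phi>)
    then have "closure {x. \<phi> n x \<noteq> 0} = {\<alpha>..\<beta>}" using assms by simp
    then show ?thesis using smooth assms by (auto simp: test_function_def)
  qed
  show "\<bar>\<phi> n x\<bar> \<le> 1" for n x
    by (auto simp: \<phi>)
  show "(\<lambda>n. \<phi> n x) \<longlonglongrightarrow> indicator {\<alpha><..<\<beta>} x" for x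
  proof (cases "\<alpha> < x \<and> x < \<beta>")
    case True
    have "(\<lambda>n. exp (- inverse (real (Suc n)) * inverse ((x - \<alpha>) * (\<beta> - x))))
        \<longlonglongrightarrow> exp (- 0 * inverse ((x - \<alpha>) * (\<beta> - x)))"
      by (intro tendsto_intros LIMSEQ_inverse_real_of_nat)
    then show ?thesis using True by (simp add: \<phi>)
  next
    case False
    then show ?thesis by (auto simp: \<phi>)
  qed
qed

lemma test_function_differentiable:
  assumes "test_function a b \<phi>"
  shows "\<phi> differentiable (at x)" "deriv \<phi> differentiable (at x)"
proof -
  have k: "((deriv ^^ k) \<phi>) differentiable (at x)" for k
    using assms by (simp add: test_function_def)
  show "\<phi> differentiable (at x)" "deriv \<phi> differentiable (at x)"
    using k[of 0] k[of 1] by simp_all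
qed

lemma test_function_borel:
  assumes "test_function a b \<phi>"
  shows "\<phi> \<in> borel_measurable (lebesgue_on S)"
proof -
  have "continuous_on UNIV \<phi>"
    using test_function_differentiable(1)[OF assms]
    by (intro continuous_at_imp_continuous_on ballI differentiable_imp_continuous_within)
  then show ?thesis
    by (intro measurable_restrict_space1 measurable_completion) (simp add: borel_measurable_continuous_onI)
qed

text \<open>
  The difference \<open>s\<close> of two weak derivatives has zero integral over every compact subinterval. The
  weak* criterion, applied to the constant sequence \<open>s\<close> and to \<open>s\<close> itself as test function, then
  gives \<open>\<integral> s \<bullet> s = 0\<close>.
\<close>

lemma weak_deriv_unique:
  fixes u v w :: "real \<Rightarrow> 'e::euclidean_space"
  assumes ab: "a < b" and v: "v \<in> Linf a b" "has_weak_deriv a b u v"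
    and w: "w \<in> Linf a b" "has_weak_deriv a b u w"
  shows "AE x in lebesgue_on {a<..<b}. v x = w x"
proof -
  let ?M = "lebesgue_on {a<..<b}"
  interpret finite_measure ?M by (rule finite_measure_lebesgue_interval)
  define s where "s x = v x - w x" for x
  obtain C D where C: "AE x in ?M. norm (v x) \<le> C" and D: "AE x in ?M. norm (w x) \<le> D"
    using v w by (auto simp: Linf_def)
  from C D have bound: "AE x in ?M. norm (s x) \<le> C + D"
  proof eventually_elim
    case (elim x)
    then show ?case unfolding s_def using norm_triangle_ineq4[of "v x" "w x"] by linarith
  qed
  have meas[measurable]: "v \<in> borel_measurable ?M" "w \<in> borel_measurable ?M"
    using v w by (auto simp: Linf_def)
  have s[measurable]: "s \<in> borel_measurable ?M" unfolding s_def by measurable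
  have int_s: "integrable ?M s" using bound s by (rule integrable_const_bound)
  have int_vw: "integrable ?M v" "integrable ?M w"
    using C D meas by (auto intro: integrable_const_bound)
  have test: "(LINT x|?M. \<phi> x *\<^sub>R s x) = 0"
    if \<phi>: "test_function a b \<phi>" "\<And>x. \<bar>\<phi> x\<bar> \<le> 1" for \<phi>
  proof -
    note [measurable] = test_function_borel[OF \<phi>(1)]
    have int: "integrable ?M (\<lambda>x. \<phi> x *\<^sub>R f x)" if "integrable ?M f" for f :: "real \<Rightarrow> 'e"
    proof (rule Bochner_Integration.integrable_bound[OF that])
      show "(\<lambda>x. \<phi> x *\<^sub>R f x) \<in> borel_measurable ?M"
        using that by (intro borel_measurable_scaleR) auto
      show "AE x in ?M. norm (\<phi> x *\<^sub>R f x) \<le> norm (f x)"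
        using \<phi>(2) by (auto simp: mult_left_le_one_le)
    qed
    have "(LINT x|?M. \<phi> x *\<^sub>R v x) = (LINT x|?M. \<phi> x *\<^sub>R w x)"
      using v(2)[unfolded has_weak_deriv_def, rule_format, OF \<phi>(1)]
        w(2)[unfolded has_weak_deriv_def, rule_format, OF \<phi>(1)] by simp
    then show ?thesis
      using int[OF int_vw(1)] int[OF int_vw(2)] by (simp add: s_def scaleR_diff_right)
  qed
  have intervals: "(LINT x|?M. indicator {\<alpha><..<\<beta>} x *\<^sub>R s x) = 0"
    if "a < \<alpha>" "\<alpha> < \<beta>" "\<beta> < b" for \<alpha> \<beta>
  proof -
    obtain \<phi> :: "nat \<Rightarrow> real \<Rightarrow> real" where
      \<phi>: "\<And>n. test_function a b (\<phi> n)" "\<And>n x. \<bar>\<phi> n x\<bar> \<le> 1"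
        "\<And>x. (\<lambda>n. \<phi> n x) \<longlonglongrightarrow> indicator {\<alpha><..<\<beta>} x"
      using test_function_approximates_interval[OF \<open>a < \<alpha>\<close> \<open>\<alpha> < \<beta>\<close> \<open>\<beta> < b\<close>] by blast
    note \<phi>_meas = test_function_borel[OF \<phi>(1)]
    have "(\<lambda>n. LINT x|?M. \<phi> n x *\<^sub>R s x) \<longlonglongrightarrow> (LINT x|?M. indicator {\<alpha><..<\<beta>} x *\<^sub>R s x)"
    proof (rule integral_dominated_convergence)
      show "(\<lambda>x. indicator {\<alpha><..<\<beta>} x *\<^sub>R s x) \<in> borel_measurable ?M"
        by (intro borel_measurable_scaleR s borel_measurable_indicator) (use that in \<open>auto simp: sets_restrict_space_iff\<close>)
      show "(\<lambda>x. \<phi> n x *\<^sub>R s x) \<in> borel_measurable ?M" for n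
        by (intro borel_measurable_scaleR s \<phi>_meas)
      show "integrable ?M (\<lambda>x. norm (s x))" using int_s by simp
      show "AE x in ?M. (\<lambda>n. \<phi> n x *\<^sub>R s x) \<longlonglongrightarrow> indicator {\<alpha><..<\<beta>} x *\<^sub>R s x"
        by (intro AE_I2 tendsto_intros \<phi>(3))
      show "AE x in ?M. norm (\<phi> n x *\<^sub>R s x) \<le> norm (s x)" for n
        using \<phi>(2) by (auto simp: mult_left_le_one_le)
    qed
    then show ?thesis using test[OF \<phi>(1,2)] by (simp add: LIMSEQ_const_iff)
  qed
  have "(\<lambda>j::nat. LINT x|?M. s x \<bullet> s x) \<longlonglongrightarrow> 0"
    by (rule weak_star_zero_of_interval_integrals[OF ab _ bound _ int_s]) (auto simp: intervals)
  then have zero: "(LINT x|?M. s x \<bullet> s x) = 0" by (simp add: LIMSEQ_const_iff)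
  have "integrable ?M (\<lambda>x. s x \<bullet> s x)"
  proof (rule integrable_const_bound)
    show "AE x in ?M. norm (s x \<bullet> s x) \<le> (C + D)\<^sup>2"
      using bound by eventually_elim (simp add: dot_square_norm power_mono)
  qed simp
  then have "AE x in ?M. s x \<bullet> s x = 0"
    using zero by (simp add: integral_nonneg_eq_0_iff_AE)
  then show ?thesis by eventually_elim (simp add: s_def)
qed

section \<open>Primitives\<close>

definition primitive :: "real \<Rightarrow> real \<Rightarrow> (real \<Rightarrow> 'e::euclidean_space) \<Rightarrow> real \<Rightarrow> 'e" where
  "primitive a b v x = (LINT y|lebesgue_on {a<..<b}. indicator {..<x} y *\<^sub>R v y)"

lemma integral_lebesgue_on_borel:
  fixes f :: "real \<Rightarrow> 'e::euclidean_space"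
  assumes "f \<in> borel_measurable borel"
  shows "(LINT x|lebesgue_on {a<..<b}. f x) = (LINT x|lborel. indicator {a<..<b} x *\<^sub>R f x)"
  using assms by (simp add: integral_restrict_space integral_completion)

lemma primitive_in_Linf:
  fixes v :: "real \<Rightarrow> 'e::euclidean_space"
  assumes ab: "a < b" and v[measurable]: "v \<in> borel_measurable borel" and C: "\<And>x. norm (v x) \<le> C"
  shows "primitive a b v \<in> borel_measurable (lebesgue_on {a<..<b})"
    "norm (primitive a b v x) \<le> C * (b - a)"
proof -
  have "(\<lambda>x. LINT y|lborel. indicator {a<..<b} y *\<^sub>R (if y < x then v y else 0)) \<in> borel_measurable borel"
    by measurable
  moreover have "primitive a b v x = (LINT y|lborel. indicator {a<..<b} y *\<^sub>R (if y < x then v y else 0))" for x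
  proof -
    have "(\<lambda>y. indicator {..<x} y *\<^sub>R v y) = (\<lambda>y. if y < x then v y else 0)"
      by (auto simp: indicator_def)
    then show ?thesis unfolding primitive_def by (simp add: integral_lebesgue_on_borel)
  qed
  ultimately have "primitive a b v \<in> borel_measurable borel"
    by (simp cong: measurable_cong)
  then show "primitive a b v \<in> borel_measurable (lebesgue_on {a<..<b})"
    by (intro measurable_restrict_space1 measurable_completion) simp
  interpret finite_measure "lebesgue_on {a<..<b}" by (rule finite_measure_lebesgue_interval)
  have [simp]: "C \<ge> 0" using C[of 0] norm_ge_zero order_trans by blast
  have vm: "v \<in> borel_measurable (lebesgue_on {a<..<b})"
    by (intro measurable_restrict_space1 measurable_completion) simp
  have iv: "integrable (lebesgue_on {a<..<b}) v"
    using C vm by (intro integrable_const_bound[of _ C]) auto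
  have S: "{..<x} \<inter> {a<..<b} \<in> sets (lebesgue_on {a<..<b})" by (auto simp: sets_restrict_space_iff)
  have "norm (primitive a b v x) \<le> (LINT y|lebesgue_on {a<..<b}. C)"
  proof -
    have "norm (primitive a b v x) \<le> (LINT y|lebesgue_on {a<..<b}. norm (indicator {..<x} y *\<^sub>R v y))"
      unfolding primitive_def by (rule integral_norm_bound)
    also have "\<dots> \<le> (LINT y|lebesgue_on {a<..<b}. C)"
    proof (rule integral_mono_AE)
      show le: "AE y in lebesgue_on {a<..<b}. norm (indicator {..<x} y *\<^sub>R v y) \<le> C"
        using C by (auto simp: indicator_def)
      show "integrable (lebesgue_on {a<..<b}) (\<lambda>y. norm (indicator {..<x} y *\<^sub>R v y))"
        using le by (intro integrable_norm integrable_const_bound[OF le] borel_measurable_scaleR vm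
          measurable_restrict_space1 measurable_completion borel_measurable_indicator) auto
    qed simp
    finally show ?thesis .
  qed
  also have "\<dots> = C * (b - a)"
    using ab by (simp add: measure_restrict_space)
  finally show "norm (primitive a b v x) \<le> C * (b - a)" .
qed

text \<open>
  Integration by parts by exchanging the integrals of \<open>\<phi>'(x) v(y)\<close> over \<open>a < y < x < b\<close>: the inner
  integral over \<open>x\<close> is \<open>\<phi>(b) - \<phi>(y) = - \<phi>(y)\<close>.
\<close>

lemma has_weak_deriv_primitive:
  fixes v :: "real \<Rightarrow> 'e::euclidean_space"
  assumes ab: "a < b" and v[measurable]: "v \<in> borel_measurable borel" and C: "\<And>x. norm (v x) \<le> C"
  shows "has_weak_deriv a b (primitive a b v) v"
  unfolding has_weak_deriv_def
proof (intro allI impI)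
  fix \<phi> :: "real \<Rightarrow> real" assume test: "test_function a b \<phi>"
  note diff = test_function_differentiable[OF test]
  have d\<phi>: "(\<phi> has_real_derivative deriv \<phi> x) (at x)" for x
    using diff(1)[of x] by (simp add: DERIV_deriv_iff_real_differentiable)
  have cont: "isCont (deriv \<phi>) x" for x
    using diff(2) by (rule differentiable_imp_continuous_within)
  have "continuous_on UNIV \<phi>" "continuous_on UNIV (deriv \<phi>)"
    by (auto intro!: continuous_at_imp_continuous_on cont DERIV_isCont d\<phi>)
  then have [measurable]: "\<phi> \<in> borel_measurable borel" "deriv \<phi> \<in> borel_measurable borel"
    by (auto intro: borel_measurable_continuous_onI)
  have \<phi>b: "\<phi> b = 0"
  proof (rule ccontr)
    assume "\<phi> b \<noteq> 0"
    then have "b \<in> closure {x. \<phi> x \<noteq> 0}" using closure_subset[of "{x. \<phi> x \<noteq> 0}"] by blast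
    then show False using test by (auto simp: test_function_def)
  qed
  have "compact (deriv \<phi> ` {a..b})"
    using cont by (intro compact_continuous_image continuous_at_imp_continuous_on) auto
  then obtain D where "\<forall>z\<in>deriv \<phi> ` {a..b}. norm z \<le> D"
    using compact_imp_bounded[of "deriv \<phi> ` {a..b}"] unfolding bounded_iff by blast
  then have D: "norm (deriv \<phi> x) \<le> D" if "x \<in> {a..b}" for x using that by blast
  have D0: "D \<ge> 0" using D[of a] ab by (force intro: order_trans[OF norm_ge_zero])
  have C0: "C \<ge> 0" using C[of 0] norm_ge_zero order_trans by blast
  let ?I = "{a<..<b}"
  define k where "k x y = (indicator ?I x * indicator ?I y * (if y < x then deriv \<phi> x else 0)) *\<^sub>R v y"
    for x y
  have k: "integrable (lborel \<Otimes>\<^sub>M lborel) (case_prod k)"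
  proof (rule Bochner_Integration.integrable_bound)
    have "emeasure (lborel \<Otimes>\<^sub>M lborel) (?I \<times> ?I) < \<infinity>"
      using ab by (simp add: lborel.emeasure_pair_measure_Times ennreal_mult_less_top)
    then show "integrable (lborel \<Otimes>\<^sub>M lborel) (\<lambda>p. (D * C) * indicator (?I \<times> ?I) p)"
      by (intro integrable_mult_right integrable_real_indicator) auto
    show "case_prod k \<in> borel_measurable (lborel \<Otimes>\<^sub>M lborel)"
      unfolding k_def by measurable
    have "norm (k x y) \<le> norm (D * C * indicator (?I \<times> ?I) (x, y))" for x y
    proof (cases "x \<in> ?I \<and> y \<in> ?I \<and> y < x")
      case True
      have "\<bar>deriv \<phi> x\<bar> * norm (v y) \<le> D * C"
        using D[of x] C[of y] D0 True by (intro mult_mono) auto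
      then show ?thesis using True C0 D0 by (simp add: k_def)
    next
      case False
      then show ?thesis by (auto simp: k_def indicator_def)
    qed
    then show "AE p in lborel \<Otimes>\<^sub>M lborel. norm (case_prod k p) \<le> norm (D * C * indicator (?I \<times> ?I) p)"
      by auto
  qed
  have inner_y: "(LINT y|lborel. k x y) = indicator ?I x *\<^sub>R (deriv \<phi> x *\<^sub>R primitive a b v x)" for x
  proof -
    have "(LINT y|lborel. k x y) =
      (LINT y|lborel. (indicator ?I x * deriv \<phi> x) *\<^sub>R (indicator ?I y *\<^sub>R (indicator {..<x} y *\<^sub>R v y)))"
      by (intro Bochner_Integration.integral_cong) (auto simp: k_def indicator_def)
    also have "\<dots> = (indicator ?I x * deriv \<phi> x) *\<^sub>R primitive a b v x"
      unfolding primitive_def by (subst integral_lebesgue_on_borel, measurable) (rule integral_scaleR_right)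
    finally show ?thesis by simp
  qed
  have inner_x: "(LINT x|lborel. k x y) = - (indicator ?I y *\<^sub>R (\<phi> y *\<^sub>R v y))" for y
  proof (cases "y \<in> ?I")
    case False
    then show ?thesis by (simp add: k_def)
  next
    case True
    have "(LINT x|lborel. k x y) = (LINT x|lborel. (deriv \<phi> x * indicator {y..b} x) *\<^sub>R v y)"
    proof (rule integral_cong_AE)
      show "AE x in lborel. k x y = (deriv \<phi> x * indicator {y..b} x) *\<^sub>R v y"
        using AE_lborel_singleton[of y] AE_lborel_singleton[of b]
        by eventually_elim (use True in \<open>auto simp: k_def indicator_def\<close>)
    qed (simp_all add: k_def)
    also have "\<dots> = (LINT x|lborel. deriv \<phi> x * indicator {y..b} x) *\<^sub>R v y"
      by (rule integral_scaleR_left)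
        (use True in \<open>auto intro!: borel_integrable_atLeastAtMost cont simp: mult.commute\<close>)
    also have "(LINT x|lborel. deriv \<phi> x * indicator {y..b} x) = \<phi> b - \<phi> y"
      using True by (intro integral_FTC_Icc_real d\<phi> cont) auto
    finally show ?thesis using True \<phi>b by simp
  qed
  have "(LINT x|lebesgue_on ?I. deriv \<phi> x *\<^sub>R primitive a b v x) = (LINT x|lborel. LINT y|lborel. k x y)"
  proof -
    have "(LINT x|lebesgue_on ?I. deriv \<phi> x *\<^sub>R primitive a b v x) =
      (LINT x|lebesgue. indicator ?I x *\<^sub>R (deriv \<phi> x *\<^sub>R primitive a b v x))"
      by (rule integral_restrict_space) simp
    also have "\<dots> = (LINT x|lebesgue. LINT y|lborel. k x y)" by (simp only: inner_y)
    also have "\<dots> = (LINT x|lborel. LINT y|lborel. k x y)"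
      by (rule integral_completion) (simp add: k_def)
    finally show ?thesis .
  qed
  also have "\<dots> = (LINT y|lborel. LINT x|lborel. k x y)"
    using lborel_pair.Fubini_integral[OF k] by simp
  also have "\<dots> = - (LINT y|lborel. indicator ?I y *\<^sub>R (\<phi> y *\<^sub>R v y))"
    by (simp only: inner_x Bochner_Integration.integral_minus)
  also have "\<dots> = - (LINT x|lebesgue_on ?I. \<phi> x *\<^sub>R v x)"
    by (subst integral_lebesgue_on_borel) simp_all
  finally show "(LINT x|lebesgue_on ?I. deriv \<phi> x *\<^sub>R primitive a b v x) = - (LINT x|lebesgue_on ?I. \<phi> x *\<^sub>R v x)" .
qed

lemma bounded_borel_in_Linf:
  fixes v :: "real \<Rightarrow> 'e::euclidean_space"
  assumes "v \<in> borel_measurable borel" "\<And>x. norm (v x) \<le> C"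
  shows "v \<in> Linf a b"
  unfolding Linf_def using assms
  by (auto intro!: measurable_restrict_space1 measurable_completion exI[of _ C])

lemma primitive_in_W1inf:
  fixes v :: "real \<Rightarrow> 'e::euclidean_space"
  assumes "a < b" "v \<in> borel_measurable borel" "\<And>x. norm (v x) \<le> C"
  shows "primitive a b v \<in> W1inf a b"
proof -
  have "primitive a b v \<in> Linf a b"
    unfolding Linf_def using primitive_in_Linf[OF assms] by auto
  then show ?thesis
    unfolding W1inf_def using has_weak_deriv_primitive[OF assms] bounded_borel_in_Linf[OF assms(2,3)]
    by blast
qed

lemma weak_deriv_primitive:
  fixes v :: "real \<Rightarrow> 'e::euclidean_space"
  assumes "a < b" "v \<in> borel_measurable borel" "\<And>x. norm (v x) \<le> C"
  shows "AE x in lebesgue_on {a<..<b}. weak_deriv a b (primitive a b v) x = v x"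
  using weak_deriv_unique[OF assms(1) weak_deriv_works[OF primitive_in_W1inf[OF assms]]
    bounded_borel_in_Linf[OF assms(2,3)] has_weak_deriv_primitive[OF assms]] .

text \<open>
  Weak* convergence of the derivatives gives pointwise convergence of the uniformly bounded
  primitives, so only the derivatives have to be examined.
\<close>

lemma weak_star_conv_primitive:
  fixes v :: "nat \<Rightarrow> real \<Rightarrow> 'e::euclidean_space"
  assumes ab: "a < b"
    and v: "\<And>j. v j \<in> borel_measurable borel" "\<And>j x. norm (v j x) \<le> C"
    and w: "w \<in> borel_measurable borel" "\<And>x. norm (w x) \<le> C"
    and conv: "Linf_weak_star_conv a b v w"
  shows "W1inf_weak_star_conv a b (\<lambda>j. primitive a b (v j)) (primitive a b w)"
  unfolding W1inf_weak_star_conv_def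
proof
  let ?M = "lebesgue_on {a<..<b}"
  note pv = primitive_in_Linf[OF ab v] and pw = primitive_in_Linf[OF ab w]
  have lim: "(\<lambda>j. primitive a b (v j) x) \<longlonglongrightarrow> primitive a b w x" for x
  proof -
    have P: "{a<..<b} \<inter> {..<x} \<in> sets ?M" by (auto simp: sets_restrict_space_iff)
    have "primitive a b f x = (LINT y|?M. indicator ({a<..<b} \<inter> {..<x}) y *\<^sub>R f y)" for f :: "real \<Rightarrow> 'e"
      unfolding primitive_def
      by (intro Bochner_Integration.integral_cong) (auto simp: indicator_def space_restrict_space)
    then show ?thesis
      using Linf_weak_star_conv_set_integral[OF conv P]
        integrable_Linf[OF bounded_borel_in_Linf[OF v]] integrable_Linf[OF bounded_borel_in_Linf[OF w]]
      by simp
  qed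
  show "Linf_weak_star_conv a b (\<lambda>j. primitive a b (v j)) (primitive a b w)"
    unfolding Linf_weak_star_conv_def
  proof (intro allI impI)
    fix g :: "real \<Rightarrow> 'e" assume g: "integrable ?M g"
    show "(\<lambda>j. LINT x|?M. primitive a b (v j) x \<bullet> g x) \<longlonglongrightarrow> (LINT x|?M. primitive a b w x \<bullet> g x)"
    proof (rule integral_dominated_convergence)
      show "integrable ?M (\<lambda>x. (C * (b - a)) * norm (g x))" using g by simp
      show "AE x in ?M. (\<lambda>j. primitive a b (v j) x \<bullet> g x) \<longlonglongrightarrow> primitive a b w x \<bullet> g x"
        by (intro AE_I2 tendsto_inner lim tendsto_const)
      show "AE x in ?M. norm (primitive a b (v j) x \<bullet> g x) \<le> (C * (b - a)) * norm (g x)" for j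
      proof (rule AE_I2)
        fix x
        have "norm (primitive a b (v j) x \<bullet> g x) \<le> norm (primitive a b (v j) x) * norm (g x)"
          using Cauchy_Schwarz_ineq2 by simp
        also have "\<dots> \<le> (C * (b - a)) * norm (g x)"
          using pv(2) by (rule mult_right_mono) simp
        finally show "norm (primitive a b (v j) x \<bullet> g x) \<le> (C * (b - a)) * norm (g x)" .
      qed
    qed (use g pv(1) pw(1) in \<open>auto intro!: borel_measurable_inner\<close>)
  qed
  show "Linf_weak_star_conv a b (\<lambda>j. weak_deriv a b (primitive a b (v j))) (weak_deriv a b (primitive a b w))"
    unfolding Linf_weak_star_conv_def
  proof (intro allI impI)
    fix g :: "real \<Rightarrow> 'e" assume g: "integrable ?M g"
    have eq: "(LINT x|?M. weak_deriv a b (primitive a b f) x \<bullet> g x) = (LINT x|?M. f x \<bullet> g x)"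
      if f: "f \<in> borel_measurable borel" "\<And>x. norm (f x) \<le> C" for f :: "real \<Rightarrow> 'e"
    proof (rule integral_cong_AE)
      have "weak_deriv a b (primitive a b f) \<in> borel_measurable ?M" "f \<in> borel_measurable ?M"
        using weak_deriv_works(1)[OF primitive_in_W1inf[OF ab f]] bounded_borel_in_Linf[OF f, of a b]
        by (auto simp: Linf_def)
      then show "(\<lambda>x. weak_deriv a b (primitive a b f) x \<bullet> g x) \<in> borel_measurable ?M"
        "(\<lambda>x. f x \<bullet> g x) \<in> borel_measurable ?M"
        using g by (auto intro!: borel_measurable_inner)
      show "AE x in ?M. weak_deriv a b (primitive a b f) x \<bullet> g x = f x \<bullet> g x"
        using weak_deriv_primitive[OF ab f] by eventually_elim simp
    qed
    show "(\<lambda>j. LINT x|?M. weak_deriv a b (primitive a b (v j)) x \<bullet> g x)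
        \<longlonglongrightarrow> (LINT x|?M. weak_deriv a b (primitive a b w) x \<bullet> g x)"
      using conv g unfolding Linf_weak_star_conv_def eq[OF v] eq[OF w] by blast
  qed
qed

section \<open>Rapid oscillations\<close>

text \<open>
  The 1-periodic function which rises with slope \<open>1 - s\<close> on \<open>[0, s]\<close> and falls with slope \<open>- s\<close> on
  \<open>[s, 1]\<close>: the antiderivative of the indicator of \<open>frac t < s\<close> minus its mean \<open>s\<close>.
\<close>

definition sawtooth :: "real \<Rightarrow> real \<Rightarrow> real" where
  "sawtooth s t = min (frac t) s - s * frac t"

lemma sawtooth_bounds:
  assumes "0 \<le> s" "s \<le> 1"
  shows "0 \<le> sawtooth s t" "sawtooth s t \<le> frac t" "sawtooth s t \<le> 1 - frac t"
proof -
  have f: "0 \<le> frac t" "frac t < 1" by (auto simp: frac_lt_1)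
  have "s * frac t \<le> frac t" "s * frac t \<le> s" using assms f
    by (auto intro: mult_left_le_one_le mult_left_le)
  then show "0 \<le> sawtooth s t" by (simp add: sawtooth_def)
  have "0 \<le> s * frac t" using assms f by simp
  then show "sawtooth s t \<le> frac t" by (simp add: sawtooth_def)
  have "0 \<le> (1 - s) * (1 - frac t)" using assms f by simp
  then show "sawtooth s t \<le> 1 - frac t" by (simp add: sawtooth_def algebra_simps min_def)
qed

text \<open>
  If an integer lies between \<open>t\<close> and \<open>t'\<close>, then each point has an integer within \<open>t' - t\<close>, and
  the value of the function is non-negative and at most the distance to the nearest integer.
\<close>

lemma sawtooth_lipschitz:
  assumes s: "0 \<le> s" "s \<le> 1" and "t \<le> t'"
  shows "\<bar>sawtooth s t - sawtooth s t'\<bar> \<le> t' - t"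
proof (cases "\<lfloor>t\<rfloor> = \<lfloor>t'\<rfloor>")
  case True
  define d e where "d = t' - t" and "e = s * d"
  have f: "frac t' = frac t + d" using True by (simp add: frac_def d_def)
  then have "s * frac t' = s * frac t + e" by (simp add: e_def distrib_left)
  moreover have "0 \<le> d" "0 \<le> e" "e \<le> d"
    using assms by (auto simp: d_def e_def intro: mult_left_le_one_le)
  ultimately show ?thesis
    unfolding sawtooth_def f d_def[symmetric] min_def by (simp split: if_splits; linarith)
next
  case False
  have "\<lfloor>t\<rfloor> \<le> \<lfloor>t'\<rfloor>" using assms(3) by (rule floor_mono)
  with False have "\<lfloor>t\<rfloor> + 1 \<le> \<lfloor>t'\<rfloor>" by simp
  then have "real_of_int \<lfloor>t\<rfloor> + 1 \<le> real_of_int \<lfloor>t'\<rfloor>" by linarith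
  then have "1 - frac t \<le> t' - t" "frac t' \<le> t' - t"
    using floor_correct[of t] floor_correct[of t'] unfolding frac_def by linarith+
  then show ?thesis using sawtooth_bounds[OF s, of t] sawtooth_bounds[OF s, of t'] by linarith
qed

lemma continuous_sawtooth:
  assumes "0 \<le> s" "s \<le> 1"
  shows "continuous_on UNIV (sawtooth s)"
  unfolding continuous_on_iff
proof (intro ballI allI impI)
  fix x e :: real assume "e > 0"
  have "dist (sawtooth s y) (sawtooth s x) \<le> dist y x" for y
    using sawtooth_lipschitz[OF assms, of x y] sawtooth_lipschitz[OF assms, of y x]
    unfolding dist_real_def by linarith
  then show "\<exists>d>0. \<forall>y\<in>UNIV. dist y x < d \<longrightarrow> dist (sawtooth s y) (sawtooth s x) < e"
    using \<open>e > 0\<close> by (intro exI[of _ e]) (auto intro: le_less_trans)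
qed

lemma sawtooth_derivative:
  assumes "t \<notin> \<int>" "frac t \<noteq> s"
  shows "(sawtooth s has_real_derivative (of_bool (frac t < s) - s)) (at t)"
proof -
  define n where "n = \<lfloor>t\<rfloor>"
  have n: "real_of_int n < t" "t < real_of_int n + 1"
    using assms(1) floor_correct[of t] unfolding n_def
    by (auto simp: less_le)
  have fr: "frac y = y - real_of_int n" if "real_of_int n < y" "y < real_of_int n + 1" for y
    using that by (simp add: frac_unique_iff frac_def) (smt (verit) floor_unique)
  show ?thesis
  proof (cases "frac t < s")
    case True
    let ?S = "{real_of_int n<..<real_of_int n + 1} \<inter> {..<real_of_int n + s}"
    have "((\<lambda>y. (y - real_of_int n) - s * (y - real_of_int n)) has_real_derivative (1 - s)) (at t)"
      by (auto intro!: derivative_eq_intros)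
    then have "(sawtooth s has_real_derivative (1 - s)) (at t)"
      by (rule has_field_derivative_transform_within_open[of _ _ _ ?S])
        (use True n fr in \<open>auto simp: sawtooth_def\<close>)
    then show ?thesis using True by simp
  next
    case False
    let ?S = "{real_of_int n<..<real_of_int n + 1} \<inter> {real_of_int n + s<..}"
    have "((\<lambda>y. s - s * (y - real_of_int n)) has_real_derivative (- s)) (at t)"
      by (auto intro!: derivative_eq_intros)
    then have "(sawtooth s has_real_derivative (- s)) (at t)"
      by (rule has_field_derivative_transform_within_open[of _ _ _ ?S])
        (use False assms(2) n fr in \<open>auto simp: sawtooth_def\<close>)
    then show ?thesis using False by simp
  qed
qed

text \<open>
  The frequency is \<open>Suc j\<close> and not \<open>j\<close>, so that it can be divided by.
\<close>

definition oscillation :: "real \<Rightarrow> nat \<Rightarrow> real \<Rightarrow> real" where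
  "oscillation s j x = of_bool (frac (real (Suc j) * x) < s)"

lemma oscillation_borel [measurable]: "oscillation s j \<in> borel_measurable borel"
  unfolding oscillation_def frac_def by measurable

lemma oscillation_interval_integral:
  assumes s: "0 \<le> s" "s \<le> 1" and "\<alpha> \<le> \<beta>"
  shows "((\<lambda>x. oscillation s j x - s) has_integral
    (sawtooth s (real (Suc j) * \<beta>) - sawtooth s (real (Suc j) * \<alpha>)) / real (Suc j)) {\<alpha>..\<beta>}"
proof -
  let ?k = "real (Suc j)"
  let ?F = "\<lambda>x. sawtooth s (?k * x) / ?k"
  \<comment> \<open>the kinks of \<open>?F\<close> in the interval are among the finitely many points of \<open>S\<close>\<close>
  define N where "N = {\<lfloor>?k * \<alpha>\<rfloor> - 1..\<lceil>?k * \<beta>\<rceil>}"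
  define S where "S = (\<lambda>n. real_of_int n / ?k) ` N \<union> (\<lambda>n. (real_of_int n + s) / ?k) ` N"
  have "((\<lambda>x. oscillation s j x - s) has_integral (?F \<beta> - ?F \<alpha>)) {\<alpha>..\<beta>}"
  proof (rule fundamental_theorem_of_calculus_strong)
    show "finite S" by (simp add: S_def N_def)
    show "continuous_on {\<alpha>..\<beta>} ?F"
      by (intro continuous_intros continuous_on_compose2[OF continuous_sawtooth[OF s]]) auto
    fix x assume x: "x \<in> {\<alpha>..\<beta>} - S"
    let ?t = "?k * x"
    have t: "?k * \<alpha> \<le> ?t" "?t \<le> ?k * \<beta>" using x by (auto intro!: mult_left_mono)
    then have "\<lfloor>?k * \<alpha>\<rfloor> \<le> \<lfloor>?t\<rfloor>" "\<lfloor>?t\<rfloor> \<le> \<lceil>?k * \<beta>\<rceil>"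
      by (auto intro: floor_mono order_trans[OF floor_mono floor_le_ceiling])
    then have N: "\<lfloor>?t\<rfloor> \<in> N" by (simp add: N_def)
    have "?t \<notin> \<int>"
    proof
      assume "?t \<in> \<int>"
      then obtain n where "?t = real_of_int n" by (rule Ints_cases)
      then have int: "real_of_int \<lfloor>?t\<rfloor> = ?t" by (simp only: floor_of_int)
      have "x = ?t / ?k" by (simp del: of_nat_Suc)
      then have "x = real_of_int \<lfloor>?t\<rfloor> / ?k" by (simp only: int)
      then show False using x N unfolding S_def by blast
    qed
    moreover have "frac ?t \<noteq> s"
    proof
      assume "frac ?t = s"
      then have "x = (real_of_int \<lfloor>?t\<rfloor> + s) / ?k" by (simp add: frac_def field_simps)
      then show False using x N unfolding S_def by blast
    qed
    ultimately have "(sawtooth s has_real_derivative (of_bool (frac ?t < s) - s)) (at ?t)"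
      by (rule sawtooth_derivative)
    then have d: "((\<lambda>x. sawtooth s (?k * x)) has_real_derivative (of_bool (frac ?t < s) - s) * ?k) (at x)"
      using DERIV_chain2[of "sawtooth s" _ "\<lambda>x. ?k * x" x ?k UNIV] DERIV_cmult_Id by blast
    show "(?F has_vector_derivative oscillation s j x - s) (at x)"
      using DERIV_cdivide[OF d, of ?k]
      by (simp add: has_real_derivative_iff_has_vector_derivative oscillation_def)
  qed fact
  then show ?thesis by (simp add: diff_divide_distrib)
qed

text \<open>
  Over an interval the integral is a difference of two values of the bounded sawtooth divided by
  the frequency.
\<close>

lemma oscillation_set_integral_tendsto_zero:
  assumes ab: "a < b" and s: "0 \<le> s" "s \<le> 1" and B: "B \<in> sets (lebesgue_on {a<..<b})"
  shows "(\<lambda>j. LINT x|lebesgue_on {a<..<b}. indicator B x * (oscillation s j x - s)) \<longlonglongrightarrow> 0"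
proof -
  let ?M = "lebesgue_on {a<..<b}"
  interpret finite_measure ?M by (rule finite_measure_lebesgue_interval)
  have meas: "(\<lambda>x. oscillation s j x - s) \<in> borel_measurable ?M" for j
    by (intro measurable_restrict_space1 measurable_completion) simp
  have bd: "AE x in ?M. norm (oscillation s j x - s) \<le> 1" for j
    using s by (auto simp: oscillation_def)
  have int: "integrable ?M (\<lambda>x. oscillation s j x - s)" for j
    using bd meas by (rule integrable_const_bound)
  have "(\<lambda>j. LINT x|?M. indicator B x *\<^sub>R (oscillation s j x - s)) \<longlonglongrightarrow> 0"
  proof (rule set_integrals_tendsto_zero[OF ab meas bd _ B])
    fix \<alpha> \<beta> assume \<alpha>\<beta>: "a < \<alpha>" "\<alpha> < \<beta>" "\<beta> < b"
    have eq: "(LINT x|?M. indicator {\<alpha><..<\<beta>} x *\<^sub>R (oscillation s j x - s)) =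
      (sawtooth s (real (Suc j) * \<beta>) - sawtooth s (real (Suc j) * \<alpha>)) / real (Suc j)" for j
    proof -
      have I: "integrable ?M (\<lambda>x. indicator {\<alpha><..<\<beta>} x *\<^sub>R (oscillation s j x - s))"
        using \<alpha>\<beta> by (intro integrable_mult_indicator int) (auto simp: sets_restrict_space_iff)
      have "(LINT x|?M. indicator {\<alpha><..<\<beta>} x *\<^sub>R (oscillation s j x - s)) =
        integral {a<..<b} (\<lambda>x. indicator {\<alpha><..<\<beta>} x *\<^sub>R (oscillation s j x - s))"
        by (rule lebesgue_integral_eq_integral[OF I]) simp
      also have "\<dots> = integral {a<..<b} (\<lambda>x. if x \<in> {\<alpha><..<\<beta>} then oscillation s j x - s else 0)"
        by (rule arg_cong[where f="integral _"]) (auto simp: indicator_def)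
      also have "\<dots> = integral {\<alpha><..<\<beta>} (\<lambda>x. oscillation s j x - s)"
        using \<alpha>\<beta> by (subst integral_restrict_Int) (auto intro!: arg_cong2[where f=integral])
      also have "\<dots> = integral {\<alpha>..\<beta>} (\<lambda>x. oscillation s j x - s)"
        by (simp add: integral_open_interval_real)
      also have "\<dots> = (sawtooth s (real (Suc j) * \<beta>) - sawtooth s (real (Suc j) * \<alpha>)) / real (Suc j)"
        using \<alpha>\<beta> by (intro integral_unique oscillation_interval_integral s) simp
      finally show ?thesis .
    qed
    show "(\<lambda>j. LINT x|?M. indicator {\<alpha><..<\<beta>} x *\<^sub>R (oscillation s j x - s)) \<longlonglongrightarrow> 0"
      unfolding eq
    proof (rule Lim_null_comparison[OF _ LIMSEQ_inverse_real_of_nat], intro always_eventually allI)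
      fix j
      have "\<bar>sawtooth s x - sawtooth s y\<bar> \<le> 1" for x y
        using sawtooth_bounds[OF s, of x] sawtooth_bounds[OF s, of y] by linarith
      then show "norm ((sawtooth s (real (Suc j) * \<beta>) - sawtooth s (real (Suc j) * \<alpha>)) / real (Suc j))
          \<le> inverse (real (Suc j))"
        by (simp add: abs_divide inverse_eq_divide divide_right_mono)
    qed
  qed
  then show ?thesis by simp
qed

section \<open>Necessity: convexity from oscillating derivatives\<close>

text \<open>
  The weights are functions so that one formula covers both the oscillating sequence and its limit:
  weights with values 0 and 1 select one of the two points, constant weights give their averages.
\<close>

definition two_phase :: "real \<Rightarrow> (real \<Rightarrow> real) \<Rightarrow> 'e \<Rightarrow> 'e \<Rightarrow> (real \<Rightarrow> real) \<Rightarrow> 'e \<Rightarrow> 'e \<Rightarrow> real \<Rightarrow> 'e::real_vector" where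
  "two_phase m \<sigma> x1 x2 \<tau> y1 y2 x =
     (if x < m then \<sigma> x *\<^sub>R x1 + (1 - \<sigma> x) *\<^sub>R x2 else \<tau> x *\<^sub>R y1 + (1 - \<tau> x) *\<^sub>R y2)"

text \<open>
  The difference to the limit is a sum of two fixed vectors, each multiplied by an oscillation of
  mean zero that is cut off to one side of \<open>m\<close>; such a cut-off integrates to the integral of
  the oscillation over a smaller set.
\<close>

lemma weak_star_conv_two_phase:
  fixes x1 x2 y1 y2 :: "'e::euclidean_space"
  assumes ab: "a < b" and s: "0 \<le> s" "s \<le> 1" and t: "0 \<le> t" "t \<le> 1"
  shows "Linf_weak_star_conv a b (\<lambda>j. two_phase m (oscillation s j) x1 x2 (oscillation t j) y1 y2)
    (two_phase m (\<lambda>_. s) x1 x2 (\<lambda>_. t) y1 y2)"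
    (is "Linf_weak_star_conv a b ?v ?w")
  unfolding Linf_weak_star_conv_def
proof (intro allI impI)
  let ?M = "lebesgue_on {a<..<b}"
  interpret finite_measure ?M by (rule finite_measure_lebesgue_interval)
  fix g :: "real \<Rightarrow> 'e" assume g: "integrable ?M g"
  define d where "d j x = ?v j x - ?w x" for j x
  have d: "d j x = (indicator {..<m} x * (oscillation s j x - s)) *\<^sub>R (x1 - x2)
      + (indicator {m..} x * (oscillation t j x - t)) *\<^sub>R (y1 - y2)" for j x
    by (simp add: d_def two_phase_def algebra_simps)
  have meas: "f \<in> borel_measurable ?M" if "f \<in> borel_measurable borel" for f :: "real \<Rightarrow> 'e"
    using that by (intro measurable_restrict_space1 measurable_completion) simp
  have bdd: "\<bar>indicator A x * (oscillation r j x - r)\<bar> \<le> 1" if "0 \<le> r" "r \<le> 1" for r j A x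
    using that by (auto simp: oscillation_def indicator_def)
  have dbd: "norm (d j x) \<le> norm (x1 - x2) + norm (y1 - y2)" for j x
    unfolding d using bdd[OF s] bdd[OF t]
    by (intro norm_triangle_le add_mono) (auto intro!: mult_left_le_one_le)
  have dm: "d j \<in> borel_measurable ?M" for j
    unfolding d[abs_def] by (rule meas) measurable
  have wm: "?w \<in> borel_measurable ?M"
    unfolding two_phase_def[abs_def] by (rule meas) measurable
  have lim: "(\<lambda>j. LINT x|?M. d j x \<bullet> g x) \<longlonglongrightarrow> 0"
  proof (rule weak_star_zero_of_interval_integrals[OF ab dm _ _ g])
    show "AE x in ?M. norm (d j x) \<le> norm (x1 - x2) + norm (y1 - y2)" for j
      by (intro AE_I2 dbd)
    fix \<alpha> \<beta> assume \<alpha>\<beta>: "a < \<alpha>" "\<alpha> < \<beta>" "\<beta> < b"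
    have S: "{\<alpha><..<\<beta>} \<inter> {..<m} \<in> sets ?M" "{\<alpha><..<\<beta>} \<inter> {m..} \<in> sets ?M"
      using \<alpha>\<beta> by (auto simp: sets_restrict_space_iff)
    have I: "integrable ?M (\<lambda>x. indicator A x * (oscillation r j x - r))"
      if "A \<in> sets ?M" "0 \<le> r" "r \<le> 1" for A r j
    proof (rule integrable_const_bound)
      show "AE x in ?M. norm (indicator A x * (oscillation r j x - r)) \<le> 1"
        using bdd[OF that(2,3)] by (intro AE_I2) simp
      have "oscillation r j \<in> borel_measurable ?M"
        by (intro measurable_restrict_space1 measurable_completion) simp
      then show "(\<lambda>x. indicator A x * (oscillation r j x - r)) \<in> borel_measurable ?M"
        using that(1) by measurable
    qed
    have eq: "(LINT x|?M. indicator {\<alpha><..<\<beta>} x *\<^sub>R d j x) =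
      (LINT x|?M. indicator ({\<alpha><..<\<beta>} \<inter> {..<m}) x * (oscillation s j x - s)) *\<^sub>R (x1 - x2)
      + (LINT x|?M. indicator ({\<alpha><..<\<beta>} \<inter> {m..}) x * (oscillation t j x - t)) *\<^sub>R (y1 - y2)" for j
    proof -
      have "indicator {\<alpha><..<\<beta>} x *\<^sub>R d j x =
        (indicator ({\<alpha><..<\<beta>} \<inter> {..<m}) x * (oscillation s j x - s)) *\<^sub>R (x1 - x2)
        + (indicator ({\<alpha><..<\<beta>} \<inter> {m..}) x * (oscillation t j x - t)) *\<^sub>R (y1 - y2)" for x
        unfolding d by (auto simp: indicator_def)
      then have "(LINT x|?M. indicator {\<alpha><..<\<beta>} x *\<^sub>R d j x) = (LINT x|?M.
        (indicator ({\<alpha><..<\<beta>} \<inter> {..<m}) x * (oscillation s j x - s)) *\<^sub>R (x1 - x2)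
        + (indicator ({\<alpha><..<\<beta>} \<inter> {m..}) x * (oscillation t j x - t)) *\<^sub>R (y1 - y2))"
        by (simp only:)
      also have "\<dots> = (LINT x|?M. (indicator ({\<alpha><..<\<beta>} \<inter> {..<m}) x * (oscillation s j x - s)) *\<^sub>R (x1 - x2))
        + (LINT x|?M. (indicator ({\<alpha><..<\<beta>} \<inter> {m..}) x * (oscillation t j x - t)) *\<^sub>R (y1 - y2))"
        by (intro Bochner_Integration.integral_add integrable_scaleR_left I S s t)
      also have "\<dots> = (LINT x|?M. indicator ({\<alpha><..<\<beta>} \<inter> {..<m}) x * (oscillation s j x - s)) *\<^sub>R (x1 - x2)
        + (LINT x|?M. indicator ({\<alpha><..<\<beta>} \<inter> {m..}) x * (oscillation t j x - t)) *\<^sub>R (y1 - y2)"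
        by (intro arg_cong2[where f = plus] integral_scaleR_left I S s t)
      finally show ?thesis .
    qed
    have "(\<lambda>j. LINT x|?M. indicator {\<alpha><..<\<beta>} x *\<^sub>R d j x) \<longlonglongrightarrow> 0 *\<^sub>R (x1 - x2) + 0 *\<^sub>R (y1 - y2)"
      unfolding eq
      by (intro tendsto_intros oscillation_set_integral_tendsto_zero ab s t S)
    then show "(\<lambda>j. LINT x|?M. indicator {\<alpha><..<\<beta>} x *\<^sub>R d j x) \<longlonglongrightarrow> 0" by simp
  qed
  have Ig: "integrable ?M (\<lambda>x. f x \<bullet> g x)" if f: "f \<in> borel_measurable ?M" "\<And>x. norm (f x) \<le> C" for f C
  proof (rule Bochner_Integration.integrable_bound)
    have C0: "C \<ge> 0" using f(2)[of 0] norm_ge_zero order_trans by blast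
    show "integrable ?M (\<lambda>x. C * norm (g x))" using g by simp
    show "(\<lambda>x. f x \<bullet> g x) \<in> borel_measurable ?M" using f g by (intro borel_measurable_inner) auto
    show "AE x in ?M. norm (f x \<bullet> g x) \<le> norm (C * norm (g x))"
    proof (rule AE_I2)
      fix x
      have "\<bar>f x \<bullet> g x\<bar> \<le> norm (f x) * norm (g x)" by (rule Cauchy_Schwarz_ineq2)
      also have "\<dots> \<le> C * norm (g x)" using f(2) by (rule mult_right_mono) simp
      finally show "norm (f x \<bullet> g x) \<le> norm (C * norm (g x))" using C0 by simp
    qed
  qed
  have wb: "norm (?w x) \<le> norm (s *\<^sub>R x1 + (1 - s) *\<^sub>R x2) + norm (t *\<^sub>R y1 + (1 - t) *\<^sub>R y2)" for x
    by (simp add: two_phase_def)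
  have "(LINT x|?M. ?v j x \<bullet> g x) = (LINT x|?M. d j x \<bullet> g x) + (LINT x|?M. ?w x \<bullet> g x)" for j
    using Bochner_Integration.integral_add[OF Ig[OF dm dbd, of j] Ig[OF wm wb]]
    by (simp add: d_def inner_diff_left)
  then show "(\<lambda>j. LINT x|?M. ?v j x \<bullet> g x) \<longlonglongrightarrow> (LINT x|?M. ?w x \<bullet> g x)"
    using tendsto_add[OF lim tendsto_const[of "LINT x|?M. ?w x \<bullet> g x"]] by simp
qed

text \<open>
  The oscillating derivatives take only the values \<open>x1\<close>, \<open>x2\<close>, \<open>y1\<close>, \<open>y2\<close> in \<open>A\<close>, so their energy
  is at most \<open>c\<close>. Two separate halves of the interval are used so that the two combinations
  can be chosen independently of each other.
\<close>

lemma weak_star_lsc_two_point_convex: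
  fixes W :: "'e::euclidean_space \<times> 'e \<Rightarrow> real"
  assumes ab: "a < b" and W: "lower_semicontinuous W" and lsc: "seq_weak_star_lsc a b (J a b W)"
    and A: "A \<times> A \<subseteq> sublevel W c"
    and pts: "x1 \<in> A" "x2 \<in> A" "y1 \<in> A" "y2 \<in> A"
    and s: "0 \<le> s" "s \<le> 1" and t: "0 \<le> t" "t \<le> 1"
  shows "(s *\<^sub>R x1 + (1 - s) *\<^sub>R x2, t *\<^sub>R y1 + (1 - t) *\<^sub>R y2) \<in> sublevel W c"
proof -
  let ?M = "lebesgue_on {a<..<b}"
  define m where "m = (a + b) / 2"
  have m: "a < m" "m < b" using ab by (auto simp: m_def)
  define v where "v j = two_phase m (oscillation s j) x1 x2 (oscillation t j) y1 y2" for j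
  define w where "w = two_phase m (\<lambda>_. s) x1 x2 (\<lambda>_. t) y1 y2"
  define C where "C = norm x1 + norm x2 + norm y1 + norm y2"
  have vb: "v j \<in> borel_measurable borel" for j
    unfolding v_def two_phase_def[abs_def] by measurable
  have wb: "w \<in> borel_measurable borel"
    unfolding w_def two_phase_def[abs_def] by measurable
  have vA: "v j x \<in> A" for j x
    using pts by (auto simp: v_def two_phase_def oscillation_def)
  have combo: "norm (r *\<^sub>R p + (1 - r) *\<^sub>R q) \<le> norm p + norm q" if "0 \<le> r" "r \<le> 1" for r and p q :: 'e
    using that by (intro norm_triangle_le add_mono) (auto intro: mult_left_le_one_le)
  have phase_C: "norm (two_phase m \<sigma> x1 x2 \<tau> y1 y2 x) \<le> C"
    if "0 \<le> \<sigma> x" "\<sigma> x \<le> 1" "0 \<le> \<tau> x" "\<tau> x \<le> 1" for \<sigma> \<tau> x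
    using combo[OF that(1,2), of x1 x2] combo[OF that(3,4), of y1 y2] norm_ge_zero[of x1]
      norm_ge_zero[of x2] norm_ge_zero[of y1] norm_ge_zero[of y2]
    unfolding two_phase_def C_def by (cases "x < m") (simp_all only: if_True if_False)
  have vC: "norm (v j x) \<le> C" for j x
    unfolding v_def by (rule phase_C) (simp_all add: oscillation_def)
  have wC: "norm (w x) \<le> C" for x
    unfolding w_def by (rule phase_C) (fact s t)+
  note W1 = primitive_in_W1inf[OF ab vb vC] primitive_in_W1inf[OF ab wb wC]
  have meas: "weak_deriv a b u \<in> borel_measurable ?M" if "u \<in> W1inf a b" for u :: "real \<Rightarrow> 'e"
    using weak_deriv_works(1)[OF that] by (simp add: Linf_def)
  have "W1inf_weak_star_conv a b (\<lambda>j. primitive a b (v j)) (primitive a b w)"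
    by (rule weak_star_conv_primitive[OF ab vb vC wb wC])
      (unfold v_def w_def, rule weak_star_conv_two_phase[OF ab s t])
  then have "J a b W (primitive a b w) \<le> liminf (\<lambda>j. J a b W (primitive a b (v j)))"
    using lsc[unfolded seq_weak_star_lsc_def, rule_format,
        of "\<lambda>j. primitive a b (v j)" "primitive a b w"] W1 by simp
  also have "\<dots> \<le> ereal c"
  proof -
    have "J a b W (primitive a b (v j)) \<le> ereal c" for j
      unfolding J_le_iff_AE[OF meas[OF W1(1)] W]
      by (rule eventually_mono[OF AE_lebesgue_square_coordinates[OF _ weak_deriv_primitive[OF ab vb vC, of j]]])
        (use A vA in auto)
    then show ?thesis
      by (intro Liminf_le) (auto intro: always_eventually)
  qed
  finally have "AE p in lebesgue_on ({a<..<b} \<times> {a<..<b}).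
      (weak_deriv a b (primitive a b w) (fst p), weak_deriv a b (primitive a b w) (snd p)) \<in> sublevel W c"
    unfolding J_le_iff_AE[OF meas[OF W1(2)] W] .
  moreover have "AE p in lebesgue_on ({a<..<b} \<times> {a<..<b}).
      weak_deriv a b (primitive a b w) (fst p) = w (fst p) \<and> weak_deriv a b (primitive a b w) (snd p) = w (snd p)"
    using weak_deriv_primitive[OF ab wb wC] by (rule AE_lebesgue_square_coordinates[rotated]) simp
  ultimately have "AE p in lebesgue_on ({a<..<b} \<times> {a<..<b}). (w (fst p), w (snd p)) \<in> sublevel W c"
    by eventually_elim simp
  then have ae: "AE x in ?M. AE y in ?M. (w x, w y) \<in> sublevel W c"
    using AE_lebesgue_square_slices[of "{a<..<b}" "\<lambda>p. (w (fst p), w (snd p)) \<in> sublevel W c"] by simp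
  \<comment> \<open>\<open>w\<close> is constant on each half, and the halves are not null sets\<close>
  have nonnull: "\<not> (AE x in ?M. x \<notin> {l<..<u})" if lu: "a \<le> l" "l < u" "u \<le> b" for l u
  proof
    assume "AE x in ?M. x \<notin> {l<..<u}"
    then have "AE x in lborel. x \<notin> {l<..<u}"
      using lu by (simp add: AE_restrict_space_iff AE_completion_iff) (auto elim!: eventually_mono)
    then have "emeasure lborel {l<..<u} = 0"
      by (subst (asm) AE_iff_measurable[of "{l<..<u}"]) auto
    then show False using lu by simp
  qed
  show ?thesis
  proof (rule ccontr)
    assume contra: "\<not> ?thesis"
    have "AE x in ?M. x \<notin> {a<..<m}"
      using ae
    proof (rule eventually_mono)
      fix x assume x: "AE y in ?M. (w x, w y) \<in> sublevel W c"
      show "x \<notin> {a<..<m}"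
      proof
        assume "x \<in> {a<..<m}"
        with x contra have "AE y in ?M. y \<notin> {m<..<b}"
          by (auto elim!: eventually_mono simp: w_def two_phase_def)
        then show False using nonnull[of m b] m by simp
      qed
    qed
    then show False using nonnull[of a m] m by simp
  qed
qed

text \<open>
  Adding all two-point combinations to a set preserves the inclusion of its square in \<open>E\<close>, and the
  increasing union of the iterates is convex.
\<close>

lemma cartesian_convex_of_two_point:
  fixes E :: "('e::real_vector \<times> 'e) set"
  assumes two: "\<And>A x1 x2 y1 y2 s t. A \<times> A \<subseteq> E \<Longrightarrow> x1 \<in> A \<Longrightarrow> x2 \<in> A \<Longrightarrow> y1 \<in> A \<Longrightarrow> y2 \<in> A \<Longrightarrow>
    0 \<le> s \<Longrightarrow> s \<le> 1 \<Longrightarrow> 0 \<le> t \<Longrightarrow> t \<le> (1::real) \<Longrightarrow>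
    (s *\<^sub>R x1 + (1 - s) *\<^sub>R x2, t *\<^sub>R y1 + (1 - t) *\<^sub>R y2) \<in> E"
  shows "cartesian_convex E"
  unfolding cartesian_convex_def
proof (intro allI impI)
  fix A assume A: "A \<times> A \<subseteq> E"
  define S where "S B = {s *\<^sub>R x + (1 - s) *\<^sub>R y | s x y. x \<in> B \<and> y \<in> B \<and> 0 \<le> s \<and> s \<le> (1::real)}" for B :: "'e set"
  have S_sq: "S B \<times> S B \<subseteq> E" if "B \<times> B \<subseteq> E" for B
    using two[OF that] unfolding S_def by blast
  have S_inc: "B \<subseteq> S B" for B
  proof
    fix x assume "x \<in> B"
    moreover have "x = 1 *\<^sub>R x + (1 - 1) *\<^sub>R x" by simp
    ultimately show "x \<in> S B" unfolding S_def by (intro CollectI exI[of _ 1] exI[of _ x]) auto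
  qed
  define T where "T n = (S ^^ n) A" for n
  have T_sq: "T n \<times> T n \<subseteq> E" for n
    by (induction n) (simp_all add: T_def A S_sq)
  have T_mono: "T n \<subseteq> T k" if "n \<le> k" for n k
    by (rule lift_Suc_mono_le[OF _ that]) (simp add: T_def S_inc)
  have "convex (\<Union>n. T n)"
    unfolding convex_def
  proof (intro ballI allI impI)
    fix x y and u v :: real assume xy: "x \<in> (\<Union>n. T n)" "y \<in> (\<Union>n. T n)" and uv: "0 \<le> u" "0 \<le> v" "u + v = 1"
    then obtain n k where "x \<in> T n" "y \<in> T k" by blast
    then have "x \<in> T (max n k)" "y \<in> T (max n k)" using T_mono[of n "max n k"] T_mono[of k "max n k"] by auto
    moreover have v: "v = 1 - u" using uv by simp
    moreover have "u \<le> 1" using uv by simp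
    ultimately have "u *\<^sub>R x + v *\<^sub>R y \<in> S (T (max n k))"
      using uv(1) unfolding S_def v by blast
    then have "u *\<^sub>R x + v *\<^sub>R y \<in> T (Suc (max n k))" by (simp add: T_def)
    then show "u *\<^sub>R x + v *\<^sub>R y \<in> (\<Union>n. T n)" by blast
  qed
  moreover have "A \<subseteq> (\<Union>n. T n)" using T_def[of 0] by auto
  ultimately have hull: "convex hull A \<subseteq> (\<Union>n. T n)" by (intro hull_minimal)
  show "(convex hull A) \<times> (convex hull A) \<subseteq> E"
  proof clarify
    fix x y assume "x \<in> convex hull A" "y \<in> convex hull A"
    then obtain n k where "x \<in> T n" "y \<in> T k" using hull by blast
    then have "x \<in> T (max n k)" "y \<in> T (max n k)" using T_mono[of n "max n k"] T_mono[of k "max n k"] by auto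
    then show "(x, y) \<in> E" using T_sq by blast
  qed
qed

section \<open>The characterisation\<close>

theorem theorem1p3:
  fixes a b :: real
    and W :: "(real ^ 'd) \<times> (real ^ 'd) \<Rightarrow> real"
  assumes "a < b"
    and "coercive W"
    and "lower_semicontinuous W"
    and "diagonal W"
    and "symmetric W"
  shows "seq_weak_star_lsc a b (J a b W) \<longleftrightarrow> cartesian_level_convex W"
proof
  assume lsc: "seq_weak_star_lsc a b (J a b W)"
  show "cartesian_level_convex W"
    unfolding cartesian_level_convex_def
    by (intro allI cartesian_convex_of_two_point)
      (rule weak_star_lsc_two_point_convex[OF assms(1,3) lsc])
next
  assume "cartesian_level_convex W"
  then show "seq_weak_star_lsc a b (J a b W)"
    by (rule weak_star_lsc_of_cartesian_level_convex[OF assms(3)])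
qed

end
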